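(* There is a universal constant $K>0$ (not depending on $n$, on $c$, or on the graphs) such that for every sequence $\{G_n\}_{n\ge1}$ of finite simple graphs with $|E(G_n)|\ge1$ for all $n$, and every integer $c\ge2$ (which may be fixed or depend on $n$), $$\sup_{x\in\mathbb{R}}\left|\mathbb{P}(Z_2(G_n)\le x)-\Phi(x)\right|\le K\left(\frac{c}{|E(G_n)|}+\frac{1}{\sqrt{|E(G_n)|}}+\frac{N(C_4,G_n)}{c\,|E(G_n)|^2}\right)^{1/5}.$$
   Context: $G_n=(V(G_n),E(G_n))$ is a deterministic finite simple graph with vertex set $\{1,2,\dots,|V(G_n)|\}$ and adjacency matrix $(a_{ij}(G_n))$. In a uniformly random $c$-coloring, the colors $X_v$, $v\in V(G_n)$, are independent and uniform on $\{1,\dots,c\}$. The number of monochromatic edges is $$T_2(G_n)=\sum_{1\le s_1<s_2\le|V(G_n)|}a_{s_1s_2}(G_n)\mathbf 1\{X_{s_1}=X_{s_2}\},$$ and $Z_2(G_n)=\dfrac{T_2(G_n)-\mathbb{E}(T_2(G_n))}{\sqrt{\mathrm{Var}(T_2(G_n))}}$. $C_4$ is the cycle of length $4$, and $N(C_4,G_n)$ is the number of copies (subgraphs, not necessarily induced) of $C_4$ in $G_n$. $\Phi$ is the standard normal distribution function. *)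

theory Defs
  imports "HOL-Probability.Probability"
begin

type_synonym 'a ugraph = "'a set \<times> 'a set set"

definition verts :: "'a ugraph \<Rightarrow> 'a set" where
  "verts G = fst G"

definition edges :: "'a ugraph \<Rightarrow> 'a set set" where
  "edges G = snd G"

definition simple_graph :: "'a ugraph \<Rightarrow> bool" where
  "simple_graph G \<longleftrightarrow> finite (verts G) \<and> (\<forall>e\<in>edges G. e \<subseteq> verts G \<and> card e = 2)"

definition subgraph :: "'a ugraph \<Rightarrow> 'a ugraph \<Rightarrow> bool" where
  "subgraph S G \<longleftrightarrow> simple_graph S \<and> verts S \<subseteq> verts G \<and> edges S \<subseteq> edges G"

definition graph_iso :: "'a ugraph \<Rightarrow> 'b ugraph \<Rightarrow> bool" where
  "graph_iso H G \<longleftrightarrow>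
     (\<exists>f. bij_betw f (verts H) (verts G) \<and> edges G = (\<lambda>e. f ` e) ` edges H)"

definition num_copies :: "'a ugraph \<Rightarrow> 'b ugraph \<Rightarrow> nat" where
  "num_copies H G = card {S. subgraph S G \<and> graph_iso H S}"

definition cycle_graph :: "nat \<Rightarrow> nat ugraph" where
  "cycle_graph k = ({0..<k}, {{i, (i + 1) mod k} | i. i < k})"

definition adj :: "'a ugraph \<Rightarrow> 'a \<Rightarrow> 'a \<Rightarrow> real" where
  "adj G u v = (if {u, v} \<in> edges G then 1 else 0)"

text \<open>A coloring drawn from this distribution has independent coordinates, uniform on
  \<open>{1..c}\<close>, on \<open>verts G\<close>; it takes the irrelevant value 0 off \<open>verts G\<close>.\<close>

definition random_coloring :: "'a ugraph \<Rightarrow> nat \<Rightarrow> ('a \<Rightarrow> nat) pmf" where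
  "random_coloring G c = Pi_pmf (verts G) 0 (\<lambda>_. pmf_of_set {1..c})"

text \<open>The next two notions are meant for graphs with vertex set \<open>{1..card (verts G)}\<close>.\<close>

definition T2 :: "nat ugraph \<Rightarrow> (nat \<Rightarrow> nat) \<Rightarrow> real" where
  "T2 G X = (\<Sum>(s1, s2)\<in>{(s1, s2). 1 \<le> s1 \<and> s1 < s2 \<and> s2 \<le> card (verts G)}.
     adj G s1 s2 * of_bool (X s1 = X s2))"

definition Z2 :: "nat ugraph \<Rightarrow> nat \<Rightarrow> (nat \<Rightarrow> nat) \<Rightarrow> real" where
  "Z2 G c X =
     (T2 G X - measure_pmf.expectation (random_coloring G c) (T2 G)) /
     sqrt (measure_pmf.variance (random_coloring G c) (T2 G))"

end

theory Submission
  imports Defs "HOL-Real_Asymp.Real_Asymp"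
begin

text \<open>
  The proof is Stein's method applied directly to the centred quadratic form. Write
  \<open>Y u v\<close> for the centred indicator that \<open>u\<close> and \<open>v\<close> have the same colour, \<open>p = 1 / c\<close>, and let
  \<open>T\<close> be the sum of \<open>Y\<close> over the \<open>m\<close> edges. Each \<open>Y u v\<close> has mean zero even after fixing the
  colour of one endpoint, so distinct edges are uncorrelated and \<open>T\<close> has variance
  \<open>s\<^sup>2 = m * p * (1 - p)\<close>.

  Every edge is charged to its endpoint of lower degree (ties are broken by the vertex order), so
  that \<open>T\<close> is the sum over vertices \<open>v\<close> of \<open>D v\<close>, the sum of \<open>Y u v\<close> over the neighbours \<open>u\<close>
  that precede \<open>v\<close>. Let \<open>N v\<close> be the corresponding sum over all neighbours of \<open>v\<close>. Since
  \<open>T - N v\<close> does not involve the colour of \<open>v\<close>, the expectation of \<open>D v * f ((T - N v) / s)\<close>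
  vanishes, and a Taylor expansion (\<open>stein_identity_error\<close>) compares \<open>W * f W\<close>, where \<open>W = T / s\<close>,
  with \<open>f' W\<close>. The two error terms are the \<open>L\<^sup>2\<close> deviation from its mean of
  \<open>(\<Sum>v. D v * N v) / s\<^sup>2\<close>, and \<open>(\<Sum>v. E (\<bar>D v\<bar> * (N v)\<^sup>2)) / s ^ 3\<close>.

  The orientation is what makes both small: all neighbours preceding \<open>v\<close> have degree at least
  their own number, so there are at most \<open>sqrt (2 * m)\<close> of them (\<open>card_back_nbrs_bound\<close>).
  A star, whose centre influences all of \<open>T\<close>, is thereby handled through its leaves. The third
  moment term then follows from the Cauchy--Schwarz inequality. The first term is split into sums
  whose summands are mostly orthogonal by degeneracy (\<open>cross_sum_decomposition\<close>); for sums over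
  paths of length two the correlations that remain come
  from pairs of paths which either have the same vertices or have the same end points, and two paths with the same end points and different centres form a
  4-cycle. This is where \<open>N(C\<^sub>4)\<close> enters.

  With \<open>\<Delta>\<close> the quantity in parentheses in the theorem, both errors are \<open>O(sqrt \<Delta>)\<close>. Smoothing the
  indicator of a half-line on the scale \<open>\<delta>\<close> costs \<open>\<delta>\<close> and lets the Lipschitz constant of \<open>f'\<close>
  grow like \<open>1 / \<delta>\<close> (\<open>kolmogorov_bound_by_stein\<close>); the choice \<open>\<delta> = \<Delta> powr (1/4)\<close> gives
  the rate \<open>\<Delta> powr (1/4)\<close>, which is at most \<open>\<Delta> powr (1/5)\<close> when \<open>\<Delta> \<le> 1\<close>. When \<open>\<Delta> > 1\<close> the
  claim is trivial.
\<close>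

section \<open>Stein's equation for the standard normal distribution\<close>

text \<open>The function \<open>2 * M / (1 + w)\<close> is a supersolution of the differential equation on the right
  half-line. After multiplication by the integrating factor, its difference with \<open>g\<close> is
  decreasing and tends to \<open>0\<close>, hence nonnegative. This replaces the usual estimates of Mills'
  ratio.\<close>

text \<open>The bound controls \<open>g\<close> and \<open>w * g w\<close> at once. The left half-line reduces to the right one
  because \<open>\<lambda>w. - g (- w)\<close> solves the reflected equation.\<close>

lemma stein_decay_one_sided:
  fixes g q :: "real \<Rightarrow> real"
  assumes der: "\<And>w. (g has_real_derivative w * g w + q w) (at w)"
    and q: "\<And>w. \<bar>q w\<bar> \<le> M"
    and lim: "((\<lambda>w. g w * exp (- w\<^sup>2 / 2)) \<longlongrightarrow> 0) at_top"
    and w: "w \<ge> 0"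
  shows "g w \<le> 2 * M / (1 + w)"
proof -
  \<comment> \<open>The gap to the supersolution, times the integrating factor.\<close>
  define B where "B w = (2 * M / (1 + w) - g w) * exp (- w\<^sup>2 / 2)" for w
  define B' where "B' w = (2 * M * (- 1 / (1 + w)\<^sup>2) - (w * g w + q w)) * exp (- w\<^sup>2 / 2)
      + (2 * M / (1 + w) - g w) * (exp (- w\<^sup>2 / 2) * (- w))" for w
  have M: "M \<ge> 0" using q[of 0] by linarith
  have dB: "(B has_real_derivative B' w) (at w)" if "w \<ge> 0" for w
  proof -
    have d1: "((\<lambda>w. 2 * M / (1 + w)) has_real_derivative 2 * M * (- 1 / (1 + w)\<^sup>2)) (at w)"
      using that by (auto intro!: derivative_eq_intros simp: divide_simps power2_eq_square)
    have d2: "((\<lambda>w. exp (- w\<^sup>2 / 2)) has_real_derivative exp (- w\<^sup>2 / 2) * (- w)) (at w)"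
      by (auto intro!: derivative_eq_intros)
    show ?thesis unfolding B_def B'_def
      using DERIV_mult[OF DERIV_diff[OF d1 der] d2] by (simp add: algebra_simps)
  qed
  have neg: "B' w \<le> 0" if "w \<ge> 0" for w
  proof -
    have "1 * (1 + w)\<^sup>2 \<le> 2 * (1 + w * (1 + w))"
      using that by (simp add: power2_eq_square algebra_simps)
    then have "1 \<le> 2 * (1 + w * (1 + w)) / (1 + w)\<^sup>2"
      using that by (subst pos_le_divide_eq) auto
    then have "M * 1 \<le> M * (2 * (1 + w * (1 + w)) / (1 + w)\<^sup>2)"
      using M by (intro mult_left_mono)
    then have "M \<le> 2 * M * (1 + w * (1 + w)) / (1 + w)\<^sup>2" by (simp only: mult_1_right times_divide_eq_right ac_simps)
    then have 1: "- q w - 2 * M * (1 + w * (1 + w)) / (1 + w)\<^sup>2 \<le> 0" using q[of w] by linarith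
    have "B' w = (- q w - 2 * M * (1 + w * (1 + w)) / (1 + w)\<^sup>2) * exp (- w\<^sup>2 / 2)"
    proof -
      have "2 * M * (1 + w * (1 + w)) / (1 + w)\<^sup>2 = 2 * M / (1 + w)\<^sup>2 + w * (2 * M / (1 + w))"
        using that by (simp add: divide_simps power2_eq_square) (simp add: algebra_simps)
      then show ?thesis unfolding B'_def by (simp add: algebra_simps)
    qed
    then show ?thesis using 1 by (simp add: mult_nonpos_nonneg)
  qed
  have lim2: "(B \<longlongrightarrow> 0) at_top"
  proof -
    have a: "((\<lambda>w::real. 2 * M / (1 + w) * exp (- w\<^sup>2 / 2)) \<longlongrightarrow> 0) at_top"
      by real_asymp
    from tendsto_diff[OF a lim] show ?thesis unfolding B_def by (simp add: algebra_simps)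
  qed
  have "0 \<le> B w"
  proof (rule tendsto_upperbound[OF lim2])
    show "eventually (\<lambda>y. B y \<le> B w) at_top"
      using eventually_ge_at_top[of w]
    proof eventually_elim
      case (elim y)
      show ?case
        by (rule DERIV_nonpos_imp_nonincreasing[OF elim]) (meson dB neg w order_trans)
    qed
  qed simp
  then show ?thesis unfolding B_def by (simp add: zero_le_mult_iff)
qed

text \<open>The bound controls \<open>g\<close> and \<open>w * g w\<close> at once. The left half-line reduces to the right one
  because \<open>\<lambda>w. - g (- w)\<close> solves the reflected equation.\<close>

lemma stein_decay:
  fixes g q :: "real \<Rightarrow> real"
  assumes der: "\<And>w. (g has_real_derivative w * g w + q w) (at w)"
    and q: "\<And>w. \<bar>q w\<bar> \<le> M"
    and top: "((\<lambda>w. g w * exp (- w\<^sup>2 / 2)) \<longlongrightarrow> 0) at_top"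
    and bot: "((\<lambda>w. g w * exp (- w\<^sup>2 / 2)) \<longlongrightarrow> 0) at_bot"
  shows "\<bar>g w\<bar> \<le> 2 * M / (1 + \<bar>w\<bar>)"
proof -
  have half: "\<bar>g w\<bar> \<le> 2 * M / (1 + w)"
    if der: "\<And>w. (g has_real_derivative w * g w + q w) (at w)"
    and q: "\<And>w. \<bar>q w\<bar> \<le> M"
    and top: "((\<lambda>w. g w * exp (- w\<^sup>2 / 2)) \<longlongrightarrow> 0) at_top" and "w \<ge> 0" 
    for g q :: "real \<Rightarrow> real" and w
  proof -
    have "g w \<le> 2 * M / (1 + w)" by (rule stein_decay_one_sided[OF der q top \<open>w \<ge> 0\<close>])
    moreover have "- g w \<le> 2 * M / (1 + w)"
    proof (rule stein_decay_one_sided[of "\<lambda>w. - g w" "\<lambda>w. - q w"])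
      show "((\<lambda>w. - g w) has_real_derivative w * - g w + - q w) (at w)" for w
        using DERIV_minus[OF der[of w]] by simp
      show "((\<lambda>w. - g w * exp (- w\<^sup>2 / 2)) \<longlongrightarrow> 0) at_top" using tendsto_minus[OF top] by simp
    qed (use q \<open>w \<ge> 0\<close> in auto)
    ultimately show ?thesis by linarith
  qed
  show ?thesis
  proof (cases "w \<ge> 0")
    case True then show ?thesis using half[OF der q top True] by simp
  next
    case False
    have "\<bar>- g (- (- w))\<bar> \<le> 2 * M / (1 + - w)"
    proof (rule half[of "\<lambda>w. - g (- w)" "\<lambda>w. q (- w)"])
      show "((\<lambda>w. - g (- w)) has_real_derivative w * - g (- w) + q (- w)) (at w)" for w
        by (auto intro!: derivative_eq_intros DERIV_chain2[OF der])
      show "((\<lambda>w. - g (- w) * exp (- w\<^sup>2 / 2)) \<longlongrightarrow> 0) at_top" 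
        using tendsto_minus[OF bot] by (simp add: filterlim_at_bot_mirror)
    qed (use q False in auto)
    then show ?thesis using False by simp
  qed
qed

text \<open>The antiderivative that vanishes at \<open>-\<infinity>\<close> also vanishes at \<open>+\<infinity>\<close>, as the total integral is
  zero; both limits are used to bound Stein solutions.\<close>

lemma centered_antiderivative:
  fixes f :: "real \<Rightarrow> real"
  assumes cont: "continuous_on UNIV f" and int: "integrable lborel f" and zero: "integral\<^sup>L lborel f = 0"
  obtains F where "\<And>w. (F has_real_derivative f w) (at w)"
    "(F \<longlongrightarrow> 0) at_top" "(F \<longlongrightarrow> 0) at_bot"
proof
  define F where "F w = (\<integral>x. indicator {..w} x *\<^sub>R f x \<partial>lborel)" for w
  have [measurable]: "f \<in> borel_measurable borel" using int by simp
  have intI: "integrable lborel (\<lambda>x. indicator A x *\<^sub>R f x)" if [measurable]: "A \<in> sets borel" for A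
    by (rule integrable_mult_indicator[OF _ int]) simp
  show "(F has_real_derivative f w) (at w)" for w
  proof -
    have "((\<lambda>u. LBINT y=w-1..u. f y) has_vector_derivative (f w)) (at w within {w-1..w+1})"
      by (rule interval_integral_FTC2) (auto intro: continuous_on_subset[OF cont])
    then have "((\<lambda>u. LBINT y=w-1..u. f y) has_vector_derivative (f w)) (at w)"
      by (simp add: at_within_Icc_at)
    then have 1: "((\<lambda>u. F (w - 1) + (LBINT y=w-1..u. f y)) has_real_derivative f w) (at w)"
      by (auto simp: has_real_derivative_iff_has_vector_derivative intro!: derivative_eq_intros)
    have eq: "F (w - 1) + (LBINT y=w-1..u. f y) = F u" if "dist u w < 1" for u
    proof -
      have le: "w - 1 \<le> u" using that by (auto simp: dist_real_def)
      have "(LBINT y=w-1..u. f y) = (\<integral>x. indicator {w-1<..u} x *\<^sub>R f x \<partial>lborel)"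
        using le by (simp add: interval_integral_Ioc set_lebesgue_integral_def)
      then have "F (w - 1) + (LBINT y=w-1..u. f y) 
         = (\<integral>x. indicator {..w-1} x *\<^sub>R f x + indicator {w-1<..u} x *\<^sub>R f x \<partial>lborel)"
        unfolding F_def by (subst Bochner_Integration.integral_add[OF intI intI]) auto
      also have "\<dots> = F u" unfolding F_def using le
        by (intro Bochner_Integration.integral_cong) (auto simp: indicator_def)
      finally show ?thesis .
    qed
    show ?thesis
      by (rule has_field_derivative_transform_within[OF 1 zero_less_one]) (use eq in auto)
  qed
  show "(F \<longlongrightarrow> 0) at_top"
    using tendsto_integral_at_top[OF sets_lborel int] unfolding F_def zero .
  have intm: "integrable lborel (\<lambda>x. f (- x))"
    using lborel_integrable_real_affine[OF int, of "-1" 0] by simp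
  have zm: "integral\<^sup>L lborel (\<lambda>x. f (- x)) = 0"
    using lborel_integral_real_affine[of "-1" f 0] zero by simp
  have 2: "F (- y) = - (\<integral>x. indicator {..y} x *\<^sub>R f (- x) \<partial>lborel)" for y
  proof -
    have "F (- y) = (\<integral>x. indicator {..-y} (-x) *\<^sub>R f (- x) \<partial>lborel)"
      unfolding F_def
      by (subst lborel_integral_real_affine[of "-1" _ 0]) auto
    also have "\<dots> = (\<integral>x. f (- x) - indicator {..y} x *\<^sub>R f (- x) \<partial>lborel)"
      by (rule integral_cong_AE)
         (use AE_lborel_singleton[of y] in \<open>auto simp: indicator_def elim!: eventually_mono\<close>)
    also have "\<dots> = - (\<integral>x. indicator {..y} x *\<^sub>R f (- x) \<partial>lborel)"
      by (subst Bochner_Integration.integral_diff)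
         (simp_all add: intm integrable_mult_indicator[OF _ intm, unfolded real_scaleR_def] zm)
    finally show ?thesis .
  qed
  show "(F \<longlongrightarrow> 0) at_bot"
    unfolding filterlim_at_bot_mirror 2
    using tendsto_minus[OF tendsto_integral_at_top[OF sets_lborel intm]] by (simp add: zm)
qed

text \<open>The solution is the antiderivative of the centred test function against the Gaussian weight,
  divided by that weight. Differentiating Stein's equation shows that \<open>f'\<close> solves the same
  equation with right-hand side \<open>f + h'\<close>, so a second use of \<open>stein_decay\<close> bounds \<open>f''\<close>.\<close>

lemma stein_solution:
  fixes h h' :: "real \<Rightarrow> real" and L :: real
  assumes h: "\<And>w. 0 \<le> h w" "\<And>w. h w \<le> 1"
    and der: "\<And>w. (h has_real_derivative h' w) (at w)"
    and L: "\<And>w. \<bar>h' w\<bar> \<le> L"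
  obtains f f' where "\<And>w. (f has_real_derivative f' w) (at w)"
    "\<And>w. f' w - w * f w = h w - (\<integral>x. h x \<partial>std_normal_distribution)"
    "\<And>w. \<bar>f' w\<bar> \<le> 3" "\<And>a b. \<bar>f' a - f' b\<bar> \<le> 3 * (2 + L) * \<bar>a - b\<bar>"
proof -
  define N where "N = (\<integral>x. h x \<partial>std_normal_distribution)"
  have conth: "continuous_on UNIV h"
    using DERIV_continuous_on[of UNIV h h'] der by (simp add: has_field_derivative_at_within)
  have [measurable]: "h \<in> borel_measurable borel"
    using conth by (rule borel_measurable_continuous_onI)
  interpret S: prob_space std_normal_distribution by (rule prob_space_normal_density) simp
  have N: "0 \<le> N" "N \<le> 1"
  proof -
    show "0 \<le> N" unfolding N_def using h by (intro integral_nonneg_AE) auto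
    show "N \<le> 1" unfolding N_def using h 
      by (intro S.integral_le_const S.integrable_const_bound[where B=1]) auto
  qed
  define \<psi> where "\<psi> x = std_normal_density x * (h x - N)" for x
  have int1: "integrable lborel (\<lambda>x. std_normal_density x * h x)"
  proof (rule Bochner_Integration.integrable_bound[OF integrable_normal_density[of 1 0]])
    show "AE x in lborel. norm (std_normal_density x * h x) \<le> norm (std_normal_density x)"
      using h by (intro AE_I2) (auto simp: abs_mult intro!: mult_left_le)
  qed auto
  have N2: "N = (\<integral>x. std_normal_density x * h x \<partial>lborel)"
    unfolding N_def by (subst integral_density) auto
  have "continuous_on UNIV \<psi>" unfolding \<psi>_def std_normal_density_def
    by (intro continuous_intros conth) auto
  moreover have "integrable lborel \<psi>" "integral\<^sup>L lborel \<psi> = 0"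
    unfolding \<psi>_def right_diff_distrib
    by (auto intro!: Bochner_Integration.integrable_diff int1
             simp: Bochner_Integration.integral_diff[OF int1] N2[symmetric])
  ultimately obtain F where F: "\<And>w. (F has_real_derivative \<psi> w) (at w)"
    "(F \<longlongrightarrow> 0) at_top" "(F \<longlongrightarrow> 0) at_bot"
    by (rule centered_antiderivative) blast
  define f where "f w = F w * (sqrt (2 * pi) * exp (w\<^sup>2 / 2))" for w
  define f' where "f' w = w * f w + (h w - N)" for w
  have df: "(f has_real_derivative f' w) (at w)" for w
  proof -
    have "(f has_real_derivative \<psi> w * (sqrt (2 * pi) * exp (w\<^sup>2 / 2)) 
       + F w * (sqrt (2 * pi) * (exp (w\<^sup>2 / 2) * w))) (at w)"
      unfolding f_def by (auto intro!: derivative_eq_intros F simp: algebra_simps)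
    moreover have "\<psi> w * (sqrt (2 * pi) * exp (w\<^sup>2 / 2)) = h w - N"
      by (simp add: \<psi>_def std_normal_density_def exp_minus field_simps)
    ultimately show ?thesis unfolding f'_def f_def by (simp only: ac_simps)
  qed
  have fF: "f w * exp (- w\<^sup>2 / 2) = sqrt (2 * pi) * F w" for w
    unfolding f_def by (simp add: exp_minus field_simps)
  have qf: "\<bar>h w - N\<bar> \<le> 1" for w using h[of w] N by linarith
  have bf: "\<bar>f w\<bar> \<le> 2 * 1 / (1 + \<bar>w\<bar>)" for w
  proof (rule stein_decay[where q="\<lambda>w. h w - N"])
    show "(f has_real_derivative w * f w + (h w - N)) (at w)" for w using df unfolding f'_def .
    show "((\<lambda>w. f w * exp (- w\<^sup>2 / 2)) \<longlongrightarrow> 0) at_top" "((\<lambda>w. f w * exp (- w\<^sup>2 / 2)) \<longlongrightarrow> 0) at_bot"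
      unfolding fF using F(2,3) by (auto intro!: tendsto_eq_intros)
  qed (rule qf)
  have b2: "\<bar>y\<bar> \<le> 2 * M \<and> \<bar>w * y\<bar> \<le> 2 * M" if "\<bar>y\<bar> \<le> 2 * M / (1 + \<bar>w\<bar>)" "M \<ge> 0" for y M w :: real
  proof -
    have "\<bar>y\<bar> * (1 + \<bar>w\<bar>) \<le> 2 * M" using that by (simp add: pos_le_divide_eq)
    then have "\<bar>y\<bar> + \<bar>w * y\<bar> \<le> 2 * M" by (simp add: algebra_simps abs_mult)
    then show ?thesis by linarith
  qed
  have f2: "\<bar>f w\<bar> \<le> 2" "\<bar>w * f w\<bar> \<le> 2" for w using b2[OF bf[of w]] by auto
  have f'3: "\<bar>f' w\<bar> \<le> 3" for w unfolding f'_def using f2(2)[of w] qf[of w] by linarith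
  \<comment> \<open>Differentiating Stein's equation: \<open>f'\<close> solves it with right-hand side \<open>f + h'\<close>.\<close>
  have df': "(f' has_real_derivative w * f' w + (f w + h' w)) (at w)" for w
    unfolding f'_def[abs_def]
    by (rule derivative_eq_intros df der refl | simp add: f'_def)+
  have q2: "\<bar>f w + h' w\<bar> \<le> 2 + L" for w using f2(1)[of w] L[of w] by linarith
  have L0: "L \<ge> 0" using L[of 0] by linarith
  have lim0: "((\<lambda>w. f' w * exp (- w\<^sup>2 / 2)) \<longlongrightarrow> 0) H" if "((\<lambda>w::real. exp (- w\<^sup>2 / 2)) \<longlongrightarrow> 0) H" for H
  proof (rule Lim_null_comparison[of _ "\<lambda>w. 3 * exp (- w\<^sup>2 / 2)"])
    show "((\<lambda>w::real. 3 * exp (- w\<^sup>2 / 2)) \<longlongrightarrow> 0) H" using tendsto_mult_left[OF that, of 3] by simp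
  qed (use f'3 in \<open>auto simp: abs_mult\<close>)
  have bf': "\<bar>f' w\<bar> \<le> 2 * (2 + L) / (1 + \<bar>w\<bar>)" for w
  proof (rule stein_decay[where q="\<lambda>w. f w + h' w"])
    show "((\<lambda>w. f' w * exp (- w\<^sup>2 / 2)) \<longlongrightarrow> 0) at_top" by (rule lim0) real_asymp
    show "((\<lambda>w. f' w * exp (- w\<^sup>2 / 2)) \<longlongrightarrow> 0) at_bot" by (rule lim0) real_asymp
  qed (rule df', rule q2)
  have f'lip: "\<bar>f' a - f' b\<bar> \<le> 3 * (2 + L) * \<bar>a - b\<bar>" for a b
  proof -
    have "norm (f' a - f' b) \<le> (3 * (2 + L)) * norm (a - b)"
    proof (rule field_differentiable_bound[of UNIV f' "\<lambda>w. w * f' w + (f w + h' w)"])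
      show "norm (w * f' w + (f w + h' w)) \<le> 3 * (2 + L)" for w
        using b2[OF bf'[of w]] q2[of w] L0 by (auto simp: abs_if split: if_splits)
    qed (use df' in auto)
    then show ?thesis by simp
  qed
  show thesis
    by (rule that[OF df _ f'3 f'lip]) (simp add: f'_def N_def)
qed

lemma std_normal_cdf_lipschitz:
  assumes "x \<le> y"
  shows "cdf std_normal_distribution y - cdf std_normal_distribution x \<le> y - x"
proof -
  interpret S: prob_space std_normal_distribution by (rule prob_space_normal_density) simp
  have "cdf std_normal_distribution y - cdf std_normal_distribution x 
      = measure std_normal_distribution {x<..y}"
  proof -
    have "measure std_normal_distribution ({..y} - {..x}) = measure std_normal_distribution {..y} - measure std_normal_distribution {..x}"
      using assms by (intro S.finite_measure_Diff) auto
    moreover have "{..y} - {..x} = {x<..y}" by auto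
    ultimately show ?thesis by (simp add: cdf_def)
  qed
  also have "ennreal (measure std_normal_distribution {x<..y}) = emeasure std_normal_distribution {x<..y}"
    by (simp add: S.emeasure_eq_measure)
  then have "ennreal (measure std_normal_distribution {x<..y}) \<le> ennreal (y - x)"
  proof -
    have "emeasure std_normal_distribution {x<..y} = (\<integral>\<^sup>+z. ennreal (std_normal_density z) * indicator {x<..y} z \<partial>lborel)"
      by (rule emeasure_density) auto
    also have "\<dots> \<le> (\<integral>\<^sup>+z. indicator {x<..y} z \<partial>lborel)"
    proof (intro nn_integral_mono)
      fix z :: real
      have "1 \<le> sqrt (2 * pi)" using pi_ge_two by (intro real_le_rsqrt) auto
      then have "std_normal_density z \<le> 1 * 1" unfolding std_normal_density_def
        by (intro mult_mono) (auto simp: divide_simps)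
      then show "ennreal (std_normal_density z) * indicator {x<..y} z \<le> indicator {x<..y} z"
        by (auto simp: indicator_def)
    qed
    also have "\<dots> = ennreal (y - x)" using assms by simp
    finally show ?thesis by (simp add: S.emeasure_eq_measure)
  qed
  then have "measure std_normal_distribution {x<..y} \<le> y - x"
    using assms by (subst (asm) ennreal_le_iff) auto
  finally show ?thesis .
qed

text \<open>A quadratic spline that is continuously differentiable and rises from 0 to 1 on the unit
  interval, so that it yields test functions with a genuine derivative everywhere.\<close>

definition smoothstep :: "real \<Rightarrow> real" where
  "smoothstep t = 2 * (max 0 t)\<^sup>2 - 4 * (max 0 (t - 1 / 2))\<^sup>2 + 2 * (max 0 (t - 1))\<^sup>2"

lemma has_derivative_max_0_squared:
  "((\<lambda>t. (max 0 t)\<^sup>2) has_real_derivative 2 * max 0 t) (at (t::real))"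
proof -
  consider "t > 0" | "t < 0" | "t = 0" by linarith
  then show ?thesis
  proof cases
    case 1
    have "((\<lambda>t. t\<^sup>2) has_real_derivative 2 * max 0 t) (at t)" 
      using 1 by (auto intro!: derivative_eq_intros)
    then show ?thesis
      by (rule has_field_derivative_transform_within_open[of _ _ _ "{0<..}"]) (use 1 in auto)
  next
    case 2
    have "((\<lambda>t. 0) has_real_derivative 2 * max 0 t) (at t)" using 2 by auto
    then show ?thesis
      by (rule has_field_derivative_transform_within_open[of _ _ _ "{..<0}"]) (use 2 in auto)
  next
    case 3
    have "((\<lambda>h::real. (max 0 h)\<^sup>2 / h) \<longlongrightarrow> 0) (at 0)"
    proof (rule Lim_null_comparison[of _ "\<lambda>h. \<bar>h\<bar>"])
      show "\<forall>\<^sub>F h::real in at 0. norm ((max 0 h)\<^sup>2 / h) \<le> \<bar>h\<bar>"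
        by (intro always_eventually allI) (auto simp: max_def power2_eq_square)
    qed (auto intro!: tendsto_eq_intros)
    then show ?thesis using 3 by (simp add: DERIV_def)
  qed
qed

lemma smoothstep_derivative:
  "(smoothstep has_real_derivative 4 * max 0 t - 8 * max 0 (t - 1 / 2) + 4 * max 0 (t - 1)) (at t)"
proof -
  have "((\<lambda>t. (max 0 (t - a))\<^sup>2) has_real_derivative 2 * max 0 (t - a)) (at t)" for a :: real
  proof -
    have "((\<lambda>t. t - a) has_real_derivative 1) (at t)" by (auto intro!: derivative_eq_intros)
    from DERIV_chain2[OF has_derivative_max_0_squared this] show ?thesis by simp
  qed
  from this[of 0] this[of "1 / 2"] this[of 1] show ?thesis
    unfolding smoothstep_def[abs_def]
    by (auto intro!: DERIV_cong[OF DERIV_add[OF DERIV_diff]] DERIV_cmult)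
qed

lemma smoothstep_slope: "\<bar>4 * max 0 t - 8 * max 0 (t - 1 / 2) + 4 * max 0 (t - 1)\<bar> \<le> (2::real)"
  by (auto simp: max_def)

lemma smoothstep_le_0: "t \<le> 0 \<Longrightarrow> smoothstep t = 0"
  and smoothstep_ge_1: "t \<ge> 1 \<Longrightarrow> smoothstep t = 1"
  by (auto simp: smoothstep_def max_def power2_eq_square algebra_simps)

lemma smoothstep_range: "0 \<le> smoothstep t" "smoothstep t \<le> 1"
proof -
  have mono: "smoothstep a \<le> smoothstep b" if "a \<le> b" for a b
  proof (rule DERIV_nonneg_imp_nondecreasing[OF that])
    show "\<exists>y. (smoothstep has_real_derivative y) (at x) \<and> 0 \<le> y" for x
      by (rule exI, rule conjI, rule smoothstep_derivative) (auto simp: max_def)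
  qed
  show "0 \<le> smoothstep t" using mono[of "min t 0" t] smoothstep_le_0[of "min t 0"] by auto
  show "smoothstep t \<le> 1" using mono[of t "max t 1"] smoothstep_ge_1[of "max t 1"] by auto
qed

text \<open>The indicator of a half-line is squeezed between two smoothed indicators, shifted by \<open>\<delta>\<close>
  against each other, to each of which the Stein solution applies. The constants come from
  \<open>A = 3\<close> and \<open>B = 3 * (2 + 2 / \<delta>)\<close> in \<open>stein_solution\<close>, the slope of the smoothed
  indicators being at most \<open>2 / \<delta>\<close>.\<close>

theorem kolmogorov_bound_by_stein:
  fixes W :: "'a \<Rightarrow> real"
  assumes "prob_space M" and W: "W \<in> borel_measurable M" and \<delta>: "\<delta> > 0"
    and stein: "\<And>f f' A B. \<lbrakk>\<And>w. (f has_real_derivative f' w) (at w); \<And>w. \<bar>f' w\<bar> \<le> A;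
        \<And>a b. \<bar>f' a - f' b\<bar> \<le> B * \<bar>a - b\<bar>\<rbrakk>
      \<Longrightarrow> \<bar>\<integral>X. f' (W X) - W X * f (W X) \<partial>M\<bar> \<le> (A + B) * \<epsilon>"
  shows "\<bar>measure M {X\<in>space M. W X \<le> x} - cdf std_normal_distribution x\<bar> \<le> \<delta> + (9 + 6 / \<delta>) * \<epsilon>"
proof -
  interpret prob_space M by fact
  interpret S: prob_space std_normal_distribution by (rule prob_space_normal_density) simp
  note [measurable] = W
  define h where "h y w = smoothstep ((y + \<delta> - w) / \<delta>)" for y w
  have hm[measurable]: "h y \<in> borel_measurable borel" for y
    unfolding h_def smoothstep_def by measurable
  have hr: "0 \<le> h y w" "h y w \<le> 1" for y w unfolding h_def by (rule smoothstep_range)+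
  have hlo: "h y w = 1" if "w \<le> y" for y w unfolding h_def using that \<delta>
    by (intro smoothstep_ge_1) (simp add: field_simps)
  have hhi: "h y w = 0" if "w \<ge> y + \<delta>" for y w unfolding h_def using that \<delta>
    by (intro smoothstep_le_0) (simp add: field_simps)
  have close: "\<bar>(\<integral>X. h y (W X) \<partial>M) - (\<integral>w. h y w \<partial>std_normal_distribution)\<bar> \<le> (9 + 6 / \<delta>) * \<epsilon>" for y
  proof -
    define s where "s t = 4 * max 0 t - 8 * max 0 (t - 1 / 2) + 4 * max 0 (t - 1)" for t :: real
    have dh: "(h y has_real_derivative s ((y + \<delta> - w) / \<delta>) * (- 1 / \<delta>)) (at w)" for w
      unfolding h_def[abs_def] s_def
      by (rule DERIV_chain2[OF smoothstep_derivative]) 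
         (use \<delta> in \<open>auto intro!: derivative_eq_intros\<close>)
    have sb: "\<bar>s ((y + \<delta> - w) / \<delta>) * (- 1 / \<delta>)\<bar> \<le> 2 / \<delta>" for w
      using smoothstep_slope[of "(y + \<delta> - w) / \<delta>"] \<delta> 
      by (simp add: s_def[symmetric] abs_mult divide_right_mono)
    obtain f f' where f: "\<And>w. (f has_real_derivative f' w) (at w)"
      "\<And>w. f' w - w * f w = h y w - (\<integral>x. h y x \<partial>std_normal_distribution)"
      "\<And>w. \<bar>f' w\<bar> \<le> 3" "\<And>a b. \<bar>f' a - f' b\<bar> \<le> 3 * (2 + 2 / \<delta>) * \<bar>a - b\<bar>"
      using stein_solution[OF hr dh sb] by metis
    have "\<bar>\<integral>X. h y (W X) - (\<integral>x. h y x \<partial>std_normal_distribution) \<partial>M\<bar> \<le> (3 + 3 * (2 + 2 / \<delta>)) * \<epsilon>"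
      using stein[OF f(1,3,4)] unfolding f(2) .
    moreover have "(\<integral>X. h y (W X) - (\<integral>x. h y x \<partial>std_normal_distribution) \<partial>M)
      = (\<integral>X. h y (W X) \<partial>M) - (\<integral>x. h y x \<partial>std_normal_distribution)"
      using hr by (subst Bochner_Integration.integral_diff) 
        (auto simp: prob_space intro!: integrable_const_bound[where B=1])
    ultimately show ?thesis by (simp add: algebra_simps)
  qed
  have lowerP: "\<P>(X in M. W X \<le> y) \<le> (\<integral>X. h y (W X) \<partial>M)" for y
  proof -
    have "\<P>(X in M. W X \<le> y) = (\<integral>X. indicator {X\<in>space M. W X \<le> y} X \<partial>M)" by simp
    also have "\<dots> \<le> (\<integral>X. h y (W X) \<partial>M)"
      by (rule integral_mono) (use hr hlo in \<open>auto intro!: integrable_const_bound[where B=1] simp: indicator_def\<close>)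
    finally show ?thesis .
  qed
  have upperP: "(\<integral>X. h y (W X) \<partial>M) \<le> \<P>(X in M. W X \<le> y + \<delta>)" for y
  proof -
    have "(\<integral>X. h y (W X) \<partial>M) \<le> (\<integral>X. indicator {X\<in>space M. W X \<le> y + \<delta>} X \<partial>M)"
      by (rule integral_mono) (use hr hhi in \<open>auto intro!: integrable_const_bound[where B=1] simp: indicator_def\<close>)
    then show ?thesis by simp
  qed
  have lowerN: "cdf std_normal_distribution y \<le> (\<integral>w. h y w \<partial>std_normal_distribution)" for y
  proof -
    have "cdf std_normal_distribution y = (\<integral>w. indicator {..y} w \<partial>std_normal_distribution)" by (simp add: cdf_def)
    also have "\<dots> \<le> (\<integral>w. h y w \<partial>std_normal_distribution)"
      by (rule integral_mono) (use hr hlo in \<open>auto intro!: S.integrable_const_bound[where B=1] simp: indicator_def\<close>)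
    finally show ?thesis .
  qed
  have upperN: "(\<integral>w. h y w \<partial>std_normal_distribution) \<le> cdf std_normal_distribution (y + \<delta>)" for y
  proof -
    have "(\<integral>w. h y w \<partial>std_normal_distribution) \<le> (\<integral>w. indicator {..y + \<delta>} w \<partial>std_normal_distribution)"
      by (rule integral_mono) (use hr hhi in \<open>auto intro!: S.integrable_const_bound[where B=1] simp: indicator_def\<close>)
    then show ?thesis by (simp add: cdf_def)
  qed
  show ?thesis
    using lowerP[of x] upperP[of "x - \<delta>"] lowerN[of "x - \<delta>"] upperN[of x] close[of x] close[of "x - \<delta>"]
      std_normal_cdf_lipschitz[of x "x + \<delta>"] std_normal_cdf_lipschitz[of "x - \<delta>" x] \<delta>
    by (simp add: abs_le_iff)
qed

section \<open>Cauchy--Schwarz, Taylor and rate estimates\<close>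

lemma pmf_cauchy_schwarz:
  fixes g h :: "'a \<Rightarrow> real"
  assumes fin: "finite (set_pmf M)"
  shows "measure_pmf.expectation M (\<lambda>x. \<bar>g x * h x\<bar>)
    \<le> sqrt (measure_pmf.expectation M (\<lambda>x. (g x)\<^sup>2)) * sqrt (measure_pmf.expectation M (\<lambda>x. (h x)\<^sup>2))"
proof -
  have E: "measure_pmf.expectation M f = (\<Sum>x\<in>set_pmf M. f x * pmf M x)" for f :: "'a \<Rightarrow> real"
    by (rule integral_measure_pmf_real[OF fin])
  have "(\<Sum>x\<in>set_pmf M. (\<bar>g x\<bar> * sqrt (pmf M x)) * (\<bar>h x\<bar> * sqrt (pmf M x)))\<^sup>2
     \<le> (\<Sum>x\<in>set_pmf M. (\<bar>g x\<bar> * sqrt (pmf M x))\<^sup>2) * (\<Sum>x\<in>set_pmf M. (\<bar>h x\<bar> * sqrt (pmf M x))\<^sup>2)"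
    by (rule Cauchy_Schwarz_ineq_sum)
  then have "(measure_pmf.expectation M (\<lambda>x. \<bar>g x * h x\<bar>))\<^sup>2
     \<le> measure_pmf.expectation M (\<lambda>x. (g x)\<^sup>2) * measure_pmf.expectation M (\<lambda>x. (h x)\<^sup>2)"
    by (simp add: E power_mult_distrib abs_mult algebra_simps)
  then show ?thesis
    unfolding real_sqrt_mult[symmetric] by (rule real_le_rsqrt)
qed

lemma taylor_lipschitz:
  fixes f f' :: "real \<Rightarrow> real"
  assumes der: "\<And>w. (f has_real_derivative f' w) (at w)"
    and lip: "\<And>a b. \<bar>f' a - f' b\<bar> \<le> B * \<bar>a - b\<bar>"
  shows "\<bar>f a - f (a - h) - f' a * h\<bar> \<le> B * h\<^sup>2"
proof -
  have B: "B \<ge> 0" using lip[of 1 0] by (simp add: abs_le_iff)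
  define g where "g x = f x - f' a * x" for x
  have "norm (g a - g (a - h)) \<le> (B * \<bar>h\<bar>) * norm (a - (a - h))"
  proof (rule field_differentiable_bound[of "closed_segment a (a - h)" g "\<lambda>x. f' x - f' a"])
    show "(g has_field_derivative f' x - f' a) (at x within closed_segment a (a - h))" for x
      unfolding g_def by (auto intro!: derivative_eq_intros has_field_derivative_at_within[OF der])
    show "norm (f' x - f' a) \<le> B * \<bar>h\<bar>" if "x \<in> closed_segment a (a - h)" for x
    proof -
      have "\<bar>x - a\<bar> \<le> \<bar>h\<bar>" using that by (auto simp: closed_segment_eq_real_ivl split: if_splits)
      then have "B * \<bar>x - a\<bar> \<le> B * \<bar>h\<bar>" using B by (rule mult_left_mono)
      then show ?thesis using lip[of x a] by simp
    qed
  qed auto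
  then show ?thesis by (simp add: g_def algebra_simps power2_eq_square abs_mult)
qed

text \<open>The hypothesis on \<open>v\<close> is the estimate for the second moment of the deviation of the
  empirical variance; up to constants its three summands are \<open>m\<^sup>2 * p\<^sup>2\<close> times the three
  summands of the rate.\<close>

lemma variance_term_bound:
  fixes m p q N s v :: real
  assumes m: "m \<ge> 1" and p: "0 < p" "p \<le> 2 * q" and N: "N \<ge> 0" and s: "s > 0" "s\<^sup>2 = m * q"
    and v: "v \<le> 3 * (m * p + 110 * p\<^sup>2 * (2 * m * sqrt (2 * m)) + 512 * p ^ 3 * N)"
  shows "sqrt v / s\<^sup>2 \<le> 110 * sqrt (1 / (p * m) + 1 / sqrt m + p * N / m\<^sup>2)"
proof -
  define \<Delta> where "\<Delta> = 1 / (p * m) + 1 / sqrt m + p * N / m\<^sup>2"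
  have \<Delta>0: "\<Delta> \<ge> 0" unfolding \<Delta>_def using m p N by (intro add_nonneg_nonneg) auto
  have "m\<^sup>2 * p\<^sup>2 / sqrt m = p\<^sup>2 * m * sqrt m"
  proof -
    have "m\<^sup>2 = m * sqrt m * sqrt m" using m by (simp add: power2_eq_square)
    then show ?thesis using m by simp
  qed
  then have eq: "\<Delta> * (m\<^sup>2 * p\<^sup>2) = m * p + p\<^sup>2 * m * sqrt m + p ^ 3 * N"
    using m p by (simp add: \<Delta>_def algebra_simps power2_eq_square power3_eq_cube)
  have "sqrt (2 * m) \<le> 2 * sqrt m" using m by (intro real_le_lsqrt) (auto simp: power_mult_distrib)
  then have "110 * p\<^sup>2 * (2 * m * sqrt (2 * m)) \<le> 110 * p\<^sup>2 * (2 * m * (2 * sqrt m))"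
    using m p by (intro mult_left_mono) auto
  also have "\<dots> = 440 * (p\<^sup>2 * m * sqrt m)" by simp
  also have "\<dots> \<le> 512 * (p\<^sup>2 * m * sqrt m)" using m p by (intro mult_right_mono) auto
  finally have mid: "110 * p\<^sup>2 * (2 * m * sqrt (2 * m)) \<le> 512 * (p\<^sup>2 * m * sqrt m)" .
  have mp: "0 \<le> m * p" using m p by simp
  have "v \<le> 3 * (m * p + 512 * (p\<^sup>2 * m * sqrt m) + 512 * p ^ 3 * N)"
    by (rule order_trans[OF v]) (intro mult_left_mono add_mono mid order_refl, simp)
  also have "\<dots> \<le> 1536 * (m * p + p\<^sup>2 * m * sqrt m + p ^ 3 * N)"
    using mp by (simp add: algebra_simps)
  finally have "v \<le> 1536 * (m * p + p\<^sup>2 * m * sqrt m + p ^ 3 * N)" .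
  then have "v \<le> 1536 * (\<Delta> * (m\<^sup>2 * p\<^sup>2))" unfolding eq .
  also have "\<dots> \<le> 1536 * (\<Delta> * (m\<^sup>2 * (2 * q)\<^sup>2))"
    using \<Delta>0 p by (intro mult_left_mono power_mono) auto
  also have "\<dots> = 6144 * \<Delta> * (s\<^sup>2)\<^sup>2" unfolding s(2) by (simp add: power_mult_distrib)
  also have "\<dots> \<le> 110\<^sup>2 * \<Delta> * (s\<^sup>2)\<^sup>2" using \<Delta>0 by (intro mult_right_mono) auto
  finally have "sqrt v \<le> sqrt (110\<^sup>2 * \<Delta> * (s\<^sup>2)\<^sup>2)" by (rule real_sqrt_le_mono)
  also have "\<dots> = 110 * sqrt \<Delta> * s\<^sup>2" by (simp only: real_sqrt_mult real_sqrt_abs) simp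
  finally show ?thesis using s(1) unfolding \<Delta>_def[symmetric] by (simp add: pos_divide_le_eq)
qed

text \<open>With \<open>e = sqrt \<Delta> * s\<close>, where \<open>\<Delta>\<close> is the rate, the first summand of \<open>\<Delta>\<close> makes \<open>e\<close> bounded
  below by a constant and the second one makes \<open>e\<close> at least of order \<open>sqrt p * m powr (1/4)\<close>. These
  are the two factors by which \<open>v\<close> exceeds \<open>m * p \<le> 2 * s\<^sup>2\<close>.\<close>

lemma third_moment_term_bound:
  fixes m p q N s v :: real
  assumes m: "m \<ge> 1" and p: "0 < p" "p \<le> 2 * q" and N: "N \<ge> 0" and s: "s > 0" "s\<^sup>2 = m * q"
    and v: "v \<le> 2 * m * (p + 2 * p * sqrt p * sqrt (sqrt (2 * m)))"
  shows "v / s ^ 3 \<le> 110 * sqrt (1 / (p * m) + 1 / sqrt m + p * N / m\<^sup>2)"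
proof -
  define \<Delta> where "\<Delta> = 1 / (p * m) + 1 / sqrt m + p * N / m\<^sup>2"
  have \<Delta>0: "\<Delta> \<ge> 0" "\<Delta> \<ge> 1 / (p * m)" "\<Delta> \<ge> 1 / sqrt m" unfolding \<Delta>_def using m p N by auto
  define e where "e = sqrt \<Delta> * s"
  have e0: "e \<ge> 0" using \<Delta>0 s by (simp add: e_def)
  have "m * p \<le> m * (2 * q)" using m p by (intro mult_left_mono) auto
  then have mp: "m * p \<le> 2 * s\<^sup>2" unfolding s(2) by simp
  have e2: "e\<^sup>2 = \<Delta> * s\<^sup>2" using \<Delta>0 by (simp add: e_def power_mult_distrib)
  have "1 / (p * m) * (m * p / 2) \<le> \<Delta> * s\<^sup>2" using \<Delta>0 mp m p by (intro mult_mono) auto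
  then have "(1 / 2)\<^sup>2 \<le> e\<^sup>2" using m p unfolding e2 by (simp add: power2_eq_square)
  then have e1: "1 / 2 \<le> e" using e0 by (rule power2_le_imp_le)
  have "1 / sqrt m * (m * p / 2) \<le> \<Delta> * s\<^sup>2" using \<Delta>0 mp m p by (intro mult_mono) auto
  moreover have "1 / sqrt m * (m * p / 2) = p * sqrt m / 2"
  proof -
    have "1 / sqrt m * (m * p / 2) = (m / sqrt m) * p / 2" by simp
    then show ?thesis using m by (simp add: real_div_sqrt)
  qed
  ultimately have pm: "p * sqrt m \<le> 2 * e\<^sup>2" unfolding e2 by simp
  have "sqrt (2 * m) \<le> 2 * sqrt m" using m by (intro real_le_lsqrt) (auto simp: power_mult_distrib)
  then have "p * sqrt (2 * m) \<le> p * (2 * sqrt m)" using p by (intro mult_left_mono) auto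
  then have "p * sqrt (2 * m) \<le> 4 * e\<^sup>2" using pm by linarith
  then have "(sqrt p * sqrt (sqrt (2 * m)))\<^sup>2 \<le> (2 * e)\<^sup>2" using p m by (simp add: power_mult_distrib)
  then have e3: "sqrt p * sqrt (sqrt (2 * m)) \<le> 2 * e" by (rule power2_le_imp_le) (use e0 in simp)
  note v
  also have "2 * m * (p + 2 * p * sqrt p * sqrt (sqrt (2 * m))) 
     = 2 * (m * p * 1) + 4 * (m * p * (sqrt p * sqrt (sqrt (2 * m))))" by (simp add: algebra_simps)
  also have "\<dots> \<le> 2 * (2 * s\<^sup>2 * (2 * e)) + 4 * (2 * s\<^sup>2 * (2 * e))"
  proof (rule add_mono)
    have "m * p * 1 \<le> 2 * s\<^sup>2 * (2 * e)" by (rule mult_mono[OF mp]) (use e1 in simp_all)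
    then show "2 * (m * p * 1) \<le> 2 * (2 * s\<^sup>2 * (2 * e))" by (rule mult_left_mono) simp
    have "m * p * (sqrt p * sqrt (sqrt (2 * m))) \<le> 2 * s\<^sup>2 * (2 * e)"
      by (rule mult_mono[OF mp e3]) (use m p in simp_all)
    then show "4 * (m * p * (sqrt p * sqrt (sqrt (2 * m)))) \<le> 4 * (2 * s\<^sup>2 * (2 * e))" by (rule mult_left_mono) simp
  qed
  also have "\<dots> = 24 * (sqrt \<Delta> * s ^ 3)" by (simp add: e_def power2_eq_square power3_eq_cube)
  also have "\<dots> \<le> 110 * (sqrt \<Delta> * s ^ 3)" using \<Delta>0 s(1) by (intro mult_right_mono) auto
  finally show ?thesis using s(1) unfolding \<Delta>_def[symmetric] by (simp add: pos_divide_le_eq)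
qed

section \<open>Random colourings and resampling one vertex\<close>

locale colored_graph =
  fixes G :: "'a::linorder ugraph" and c :: nat
  assumes simple: "simple_graph G" and c2: "c \<ge> 2"
begin

abbreviation "V \<equiv> verts G"
abbreviation "\<Omega> \<equiv> set_pmf (random_coloring G c)"
abbreviation expect :: "(('a \<Rightarrow> nat) \<Rightarrow> real) \<Rightarrow> real" where
  "expect g \<equiv> measure_pmf.expectation (random_coloring G c) g"

text \<open>\<open>m\<close> is the number of edges, \<open>p\<close> the probability that a given edge is monochromatic, and
  \<open>q\<close> the variance of the indicator of that event.\<close>

definition m :: real where "m = real (card (edges G))"
definition p :: real where "p = 1 / real c"
definition q :: real where "q = p * (1 - p)"
definition nbrs :: "'a \<Rightarrow> 'a set" where "nbrs v = {u. {u, v} \<in> edges G}"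

lemma finV[simp, intro]: "finite V" using simple by (simp add: simple_graph_def)

lemma p_bounds: "0 < p" "p \<le> 1 / 2" "p \<le> 2 * q" "q \<le> p" "0 < q"
proof -
  show 1: "0 < p" "p \<le> 1 / 2" unfolding p_def using c2 by (auto simp: field_simps)
  have "p * p \<le> p * (1 / 2)" using 1 by (intro mult_left_mono) auto
  moreover have "0 < p * p" using 1 by simp
  ultimately show "p \<le> 2 * q" "q \<le> p" "0 < q" unfolding q_def using 1 by (auto simp: algebra_simps)
qed

lemma nbrsD:
  assumes "u \<in> nbrs v" shows "u \<in> V" "v \<in> V" "u \<noteq> v"
proof -
  from assms have e: "{u, v} \<in> edges G" by (simp add: nbrs_def)
  with simple have "{u, v} \<subseteq> V" "card {u, v} = 2" by (auto simp: simple_graph_def)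
  then show "u \<in> V" "v \<in> V" "u \<noteq> v" by auto
qed

lemma nbrs_sym: "u \<in> nbrs v \<longleftrightarrow> v \<in> nbrs u"
  by (simp add: nbrs_def insert_commute)

lemma nbrs_subset: "nbrs v \<subseteq> V" and fin_nbrs[simp, intro]: "finite (nbrs v)"
proof -
  show "nbrs v \<subseteq> V" using nbrsD by blast
  then show "finite (nbrs v)" by (rule finite_subset) simp
qed

lemma fin_edges[simp, intro]: "finite (edges G)"
  by (rule finite_subset[of _ "Pow V"]) (use simple in \<open>auto simp: simple_graph_def\<close>)

lemma fin_\<Omega>[simp, intro]: "finite \<Omega>"
  unfolding random_coloring_def by (subst set_Pi_pmf) (use c2 in auto)

lemma \<Omega>_range: "X \<in> \<Omega> \<Longrightarrow> v \<in> V \<Longrightarrow> X v \<in> {1..c}"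
  unfolding random_coloring_def using c2 by (subst (asm) set_Pi_pmf) (auto simp: PiE_dflt_def)

lemma integrable_coloring[simp, intro]: "integrable (random_coloring G c) (g :: _ \<Rightarrow> real)"
  by (rule integrable_measure_pmf_finite) simp

lemma expect_cong: "(\<And>X. X \<in> \<Omega> \<Longrightarrow> g X = h X) \<Longrightarrow> expect g = expect h"
  by (rule integral_cong_AE) (auto simp: AE_measure_pmf_iff)

lemma expect_mono: "(\<And>X. X \<in> \<Omega> \<Longrightarrow> g X \<le> h X) \<Longrightarrow> expect g \<le> expect h"
  by (rule integral_mono_AE) (auto simp: AE_measure_pmf_iff)

text \<open>The conditional expectation given the colours of all vertices other than \<open>v\<close>.\<close>

definition resample_mean :: "'a \<Rightarrow> (('a \<Rightarrow> nat) \<Rightarrow> real) \<Rightarrow> ('a \<Rightarrow> nat) \<Rightarrow> real" where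
  "resample_mean v g X = (\<Sum>a=1..c. g (X(v := a))) / c"

text \<open>Recolouring one vertex by a fresh uniform colour leaves the distribution of the colouring
  unchanged.\<close>

lemma expect_resample_mean:
  assumes v: "v \<in> V" shows "expect g = expect (resample_mean v g)"
proof -
  define U where "U = pmf_of_set {1..c}"
  define Q where "Q = Pi_pmf (V - {v}) 0 (\<lambda>_. U)"
  have U: "finite (set_pmf U)" unfolding U_def using c2 by (subst set_pmf_of_set) auto
  have RC: "random_coloring G c = bind_pmf U (\<lambda>y. bind_pmf Q (\<lambda>f. return_pmf (f(v := y))))"
    unfolding random_coloring_def Q_def U_def
    using Pi_pmf_insert'[of "V - {v}" v 0 "\<lambda>_. pmf_of_set {1..c}"] v by (simp add: insert_absorb)
  have "bind_pmf (random_coloring G c) (\<lambda>X. map_pmf (\<lambda>a. X(v := a)) U)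
      = bind_pmf Q (\<lambda>f. bind_pmf U (\<lambda>a. return_pmf (f(v := a))))"
    unfolding RC by (simp add: bind_assoc_pmf bind_return_pmf map_pmf_def)
  also have "\<dots> = random_coloring G c" unfolding RC by (rule bind_commute_pmf)
  finally have eq: "random_coloring G c = bind_pmf (random_coloring G c) (\<lambda>X. map_pmf (\<lambda>a. X(v := a)) U)" ..
  have "expect g = (\<Sum>X\<in>\<Omega>. pmf (random_coloring G c) X *\<^sub>R measure_pmf.expectation (map_pmf (\<lambda>a. X(v := a)) U) g)"
    by (subst eq, rule pmf_expectation_bind) (use U in auto)
  also have "\<dots> = (\<Sum>X\<in>\<Omega>. pmf (random_coloring G c) X *\<^sub>R resample_mean v g X)"
    using c2 by (intro sum.cong refl) (auto simp: resample_mean_def U_def integral_pmf_of_set)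
  also have "\<dots> = expect (resample_mean v g)"
    by (subst integral_measure_pmf[of \<Omega>]) auto
  finally show ?thesis .
qed

text \<open>All orthogonality relations below are instances: a quantity that averages out over
  the colour of \<open>v\<close> is uncorrelated with everything that ignores this colour.\<close>

lemma expect_orthogonal:
  assumes v: "v \<in> V" and g: "\<And>X. X \<in> \<Omega> \<Longrightarrow> resample_mean v g X = 0" and h: "\<And>X a. h (X(v := a)) = h X"
  shows "expect (\<lambda>X. g X * h X) = 0"
proof -
  have "resample_mean v (\<lambda>X. g X * h X) X = resample_mean v g X * h X" for X
    unfolding resample_mean_def h by (simp add: sum_distrib_right)
  then have "expect (resample_mean v (\<lambda>X. g X * h X)) = expect (\<lambda>X. 0)" by (intro expect_cong) (simp add: g)
  then show ?thesis by (simp add: expect_resample_mean[OF v, of "\<lambda>X. g X * h X"])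
qed

definition Y :: "'a \<Rightarrow> 'a \<Rightarrow> ('a \<Rightarrow> nat) \<Rightarrow> real" where
  "Y u v X = of_bool (X u = X v) - p"

lemma Y_commute: "Y u v = Y v u" by (auto simp: Y_def fun_eq_iff)

lemma Y_upd[simp]: "w \<noteq> u \<Longrightarrow> w \<noteq> v \<Longrightarrow> Y u v (X(w := a)) = Y u v X" by (simp add: Y_def)

lemma abs_Y_le_1: "\<bar>Y u v X\<bar> \<le> 1" using p_bounds by (auto simp: Y_def)

text \<open>\<open>Y\<close> takes only the values \<open>1 - p\<close> and \<open>- p\<close>, the two roots of this quadratic equation.\<close>

lemma Y_square: "(Y u v X)\<^sup>2 = (1 - 2 * p) * Y u v X + q"
  by (auto simp: Y_def q_def power2_eq_square algebra_simps)

text \<open>Averaging over the colour of the middle vertex contracts a path of length two to its pair of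
  end points. This identity yields the projection in the decomposition of the empirical variance.\<close>

lemma resample_mean_YY:
  assumes X: "X \<in> \<Omega>" and "u \<in> V" "w \<in> V" "u \<noteq> v" "w \<noteq> v"
  shows "resample_mean v (\<lambda>X. Y u v X * Y w v X) X = p * Y u w X"
proof -
  have u: "X u \<in> {1..c}" and w: "X w \<in> {1..c}" using \<Omega>_range assms by blast+
  have "(\<Sum>a=1..c. Y u v (X(v := a)) * Y w v (X(v := a)))
      = (\<Sum>a=1..c. of_bool (X u = X w) * of_bool (X u = a) - p * of_bool (X u = a) - p * of_bool (X w = a) + p * p)"
    using assms by (intro sum.cong) (auto simp: Y_def algebra_simps)
  also have "\<dots> = of_bool (X u = X w) - p - p + c * (p * p)"
    using u w by (simp add: sum.distrib sum_subtractf sum_distrib_left[symmetric] of_bool_def)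
  also have "\<dots> = of_bool (X u = X w) - p" using c2 by (simp add: p_def)
  finally show ?thesis unfolding resample_mean_def by (simp add: Y_def p_def)
qed

lemma resample_mean_Y:
  assumes X: "X \<in> \<Omega>" and "u \<in> V" "u \<noteq> v"
  shows "resample_mean v (Y u v) X = 0"
proof -
  have u: "X u \<in> {1..c}" using \<Omega>_range assms by blast
  have "(\<Sum>a=1..c. Y u v (X(v := a))) = (\<Sum>a=1..c. of_bool (X u = a) - p)"
    using assms by (intro sum.cong) (auto simp: Y_def)
  also have "\<dots> = 1 - c * p" using u by (simp add: sum_subtractf of_bool_def)
  also have "\<dots> = 0" using c2 by (simp add: p_def)
  finally show ?thesis unfolding resample_mean_def by simp
qed

lemma resample_mean_Y': "X \<in> \<Omega> \<Longrightarrow> u \<in> V \<Longrightarrow> u \<noteq> v \<Longrightarrow> resample_mean v (Y v u) X = 0"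
  using resample_mean_Y by (simp add: Y_commute)

lemma expect_Y_times:
  assumes "u \<in> V" "v \<in> V" "u \<noteq> v" "\<And>X a. h (X(v := a)) = h X"
  shows "expect (\<lambda>X. Y u v X * h X) = 0"
  by (rule expect_orthogonal[of v]) (use assms resample_mean_Y in auto)

lemma expect_Y:
  assumes "u \<in> V" "v \<in> V" "u \<noteq> v" shows "expect (Y u v) = 0"
  using expect_Y_times[OF assms, of "\<lambda>_. 1"] by simp

lemma expect_Y2:
  assumes "u \<in> V" "v \<in> V" "u \<noteq> v" shows "expect (\<lambda>X. (Y u v X)\<^sup>2) = q"
  unfolding Y_square using expect_Y[OF assms] by simp

lemma expect_YY:
  assumes "u \<in> V" "v \<in> V" "u \<noteq> v" "u' \<in> V" "v' \<in> V" "u' \<noteq> v'" "{u, v} \<noteq> {u', v'}"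
  shows "expect (\<lambda>X. Y u v X * Y u' v' X) = 0"
proof -
  from assms(3,6,7) consider "v \<notin> {u', v'}" | "u \<notin> {u', v'}" by fastforce
  then show ?thesis
  proof cases
    case 1 then show ?thesis using assms by (intro expect_Y_times) auto
  next
    case 2 then show ?thesis using assms expect_Y_times[of v u "Y u' v'"] by (simp add: Y_commute[of u v])
  qed
qed

definition star_sum :: "'a set \<Rightarrow> 'a \<Rightarrow> ('a \<Rightarrow> nat) \<Rightarrow> real" where
  "star_sum S v X = (\<Sum>u\<in>S. Y u v X)"

text \<open>Induction on the set of leaves: averaging over the colour of a new leaf \<open>w\<close> removes all
  terms that are linear in \<open>Y w v\<close>, and \<open>Y_square\<close> reduces higher powers to linear ones.\<close>

lemma star_sum_moments:
  assumes "v \<in> V" "S \<subseteq> V" "v \<notin> S"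
  shows "expect (star_sum S v) = 0" "expect (\<lambda>X. (star_sum S v X)\<^sup>2) = card S * q"
    "expect (\<lambda>X. (star_sum S v X) ^ 4) \<le> card S * p + 3 * (card S)\<^sup>2 * p\<^sup>2"
proof -
  have "finite S" using assms(2) by (rule finite_subset) simp
  then have "expect (star_sum S v) = 0 \<and> expect (\<lambda>X. (star_sum S v X)\<^sup>2) = card S * q \<and>
    expect (\<lambda>X. (star_sum S v X) ^ 4) \<le> card S * p + 3 * (card S)\<^sup>2 * p\<^sup>2"
    using assms
  proof (induction S)
    case empty then show ?case by (simp add: star_sum_def)
  next
    case (insert w S)
    define D where "D = star_sum S v"
    have ih: "expect D = 0" "expect (\<lambda>X. (D X)\<^sup>2) = card S * q" 
       "expect (\<lambda>X. D X ^ 4) \<le> card S * p + 3 * (card S)\<^sup>2 * p\<^sup>2"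
      using insert unfolding D_def by auto
    have w: "w \<in> V" "v \<in> V" "v \<noteq> w" using insert by auto
    have free: "D (X(w := a)) = D X" for X a
      unfolding D_def star_sum_def using insert by (intro sum.cong Y_upd) auto
    have ss: "star_sum (insert w S) v X = D X + Y w v X" for X
      using insert by (simp add: star_sum_def D_def)
    have Yt: "expect (\<lambda>X. Y w v X * h (D X)) = 0" for h
      using expect_Y_times[of v w "\<lambda>X. h (D X)"] w free by (simp add: Y_commute[of w])
    have e1: "expect (star_sum (insert w S) v) = 0"
      unfolding ss using ih(1) expect_Y[of w v] w by simp
    have "expect (\<lambda>X. (star_sum (insert w S) v X)\<^sup>2)
        = expect (\<lambda>X. (D X)\<^sup>2 + (Y w v X)\<^sup>2 + 2 * (Y w v X * D X))"
      unfolding ss by (intro expect_cong) (simp add: power2_eq_square algebra_simps)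
    also have "\<dots> = card S * q + q" using ih(2) expect_Y2[of w v] w Yt[of "\<lambda>x. x"] by simp
    finally have e2: "expect (\<lambda>X. (star_sum (insert w S) v X)\<^sup>2) = card (insert w S) * q"
      using insert by (simp add: algebra_simps)
    \<comment> \<open>Powers of \<open>Y w v\<close> are reduced to degree one; the last summand then averages out over the colour of \<open>w\<close>.\<close>
    have "expect (\<lambda>X. (star_sum (insert w S) v X) ^ 4) \<le>
        expect (\<lambda>X. D X ^ 4 + 6 * q * (D X)\<^sup>2 + (Y w v X)\<^sup>2 + 4 * (1 - 2 * p) * q * D X
         + Y w v X * (4 * D X ^ 3 + 6 * (1 - 2 * p) * (D X)\<^sup>2 + 4 * ((1 - 2 * p)\<^sup>2 + q) * D X))"
    proof (rule expect_mono)
      fix X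
      define y d where "y = Y w v X" and "d = D X"
      have y2: "y\<^sup>2 = (1 - 2 * p) * y + q" unfolding y_def by (rule Y_square)
      have y3: "y ^ 3 = ((1 - 2 * p)\<^sup>2 + q) * y + (1 - 2 * p) * q"
      proof -
        have "y ^ 3 = y * y\<^sup>2" by (simp add: power2_eq_square power3_eq_cube)
        also have "\<dots> = (1 - 2 * p) * y\<^sup>2 + q * y" by (subst y2) (simp add: algebra_simps power2_eq_square)
        also have "\<dots> = ((1 - 2 * p)\<^sup>2 + q) * y + (1 - 2 * p) * q" unfolding y2 by (simp add: algebra_simps power2_eq_square)
        finally show ?thesis .
      qed
      have "y ^ 4 = y\<^sup>2 * y\<^sup>2" by (simp add: power_add[symmetric])
      also have "\<dots> \<le> y\<^sup>2 * 1" using abs_Y_le_1[of w v X] unfolding y_def[symmetric]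
        by (intro mult_left_mono) (auto simp: abs_square_le_1)
      finally have y4: "y ^ 4 \<le> y\<^sup>2" by simp
      have "(d + y) ^ 4 = d ^ 4 + 4 * d ^ 3 * y + 6 * d\<^sup>2 * y\<^sup>2 + 4 * d * y ^ 3 + y ^ 4"
        by (simp add: power4_eq_xxxx power3_eq_cube power2_eq_square algebra_simps)
      also have "\<dots> \<le> d ^ 4 + 4 * d ^ 3 * y + 6 * d\<^sup>2 * y\<^sup>2 + 4 * d * y ^ 3 + y\<^sup>2" using y4 by simp
      also have "\<dots> = d ^ 4 + 6 * q * d\<^sup>2 + y\<^sup>2 + 4 * (1 - 2 * p) * q * d
         + y * (4 * d ^ 3 + 6 * (1 - 2 * p) * d\<^sup>2 + 4 * ((1 - 2 * p)\<^sup>2 + q) * d)"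
        unfolding y3 by (subst (1) y2) (simp add: algebra_simps)
      finally show "(star_sum (insert w S) v X) ^ 4 \<le> D X ^ 4 + 6 * q * (D X)\<^sup>2 + (Y w v X)\<^sup>2 + 4 * (1 - 2 * p) * q * D X
         + Y w v X * (4 * D X ^ 3 + 6 * (1 - 2 * p) * (D X)\<^sup>2 + 4 * ((1 - 2 * p)\<^sup>2 + q) * D X)"
        unfolding ss y_def d_def .
    qed
    also have "\<dots> = expect (\<lambda>X. D X ^ 4) + 6 * q * (card S * q) + q"
      using Yt[of "\<lambda>d. 4 * d ^ 3 + 6 * (1 - 2 * p) * d\<^sup>2 + 4 * ((1 - 2 * p)\<^sup>2 + q) * d"]
        ih(1,2) expect_Y2[of w v] w by simp
    also have "\<dots> \<le> (card S * p + 3 * (card S)\<^sup>2 * p\<^sup>2) + 6 * p * (card S * p) + p"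
      using ih(3) p_bounds by (intro add_mono mult_mono) auto
    also have "\<dots> \<le> card (insert w S) * p + 3 * (card (insert w S))\<^sup>2 * p\<^sup>2"
      using insert by (simp add: algebra_simps power2_eq_square)
    finally show ?case using e1 e2 by blast
  qed
  then show "expect (star_sum S v) = 0" "expect (\<lambda>X. (star_sum S v X)\<^sup>2) = card S * q"
    "expect (\<lambda>X. (star_sum S v X) ^ 4) \<le> card S * p + 3 * (card S)\<^sup>2 * p\<^sup>2" by auto
qed

section \<open>Orienting edges towards lower degree\<close>

definition deg :: "'a \<Rightarrow> nat" where "deg v = card (nbrs v)"

text \<open>Edges are oriented from higher to lower degree. The vertex order only breaks ties.\<close>

definition precedes :: "'a \<Rightarrow> 'a \<Rightarrow> bool" where
  "precedes u v \<longleftrightarrow> deg v < deg u \<or> (deg v = deg u \<and> u < v)"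

definition back_nbrs :: "'a \<Rightarrow> 'a set" where "back_nbrs v = {u \<in> nbrs v. precedes u v}"

lemma back_nbrs_subset: "back_nbrs v \<subseteq> nbrs v" and fin_back_nbrs[simp, intro]: "finite (back_nbrs v)"
  by (auto simp: back_nbrs_def)

lemma nbrs_irrefl[simp]: "v \<notin> nbrs v"
  using nbrsD(3) by blast

text \<open>Any orientation of the edges counts every edge once, while summing over all neighbours counts
  it twice. It is used for the orientation by degrees and for the one by the vertex order.\<close>

lemma orient_sum:
  fixes F :: "'a \<Rightarrow> 'a \<Rightarrow> real"
  assumes sym: "\<And>u v. F u v = F v u" and r: "\<And>u v. u \<noteq> v \<Longrightarrow> r u v \<longleftrightarrow> \<not> r v u"
  shows "2 * (\<Sum>v\<in>V. \<Sum>u\<in>{u\<in>nbrs v. r u v}. F u v) = (\<Sum>v\<in>V. \<Sum>u\<in>nbrs v. F u v)"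
proof -
  have *: "(\<Sum>u\<in>{u\<in>nbrs v. R u v}. F u v) = (\<Sum>u\<in>V. if u \<in> nbrs v \<and> R u v then F u v else 0)" for R v
  proof -
    have "{u\<in>nbrs v. R u v} = {u\<in>V. u \<in> nbrs v \<and> R u v}" using nbrs_subset by auto
    then show ?thesis by (simp add: sum.inter_filter)
  qed
  have "(\<Sum>v\<in>V. \<Sum>u\<in>nbrs v. F u v) = (\<Sum>v\<in>V. (\<Sum>u\<in>{u\<in>nbrs v. r u v}. F u v) + (\<Sum>u\<in>{u\<in>nbrs v. r v u}. F u v))"
  proof (intro sum.cong refl)
    fix v
    have r': "r u v \<longleftrightarrow> \<not> r v u" if "u \<in> nbrs v" for u using r[of u v] nbrsD(3)[OF that] by simp
    have "nbrs v = {u\<in>nbrs v. r u v} \<union> {u\<in>nbrs v. r v u}" using r' by auto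
    then have "(\<Sum>u\<in>nbrs v. F u v) = (\<Sum>u\<in>{u\<in>nbrs v. r u v} \<union> {u\<in>nbrs v. r v u}. F u v)" by simp
    also have "\<dots> = (\<Sum>u\<in>{u\<in>nbrs v. r u v}. F u v) + (\<Sum>u\<in>{u\<in>nbrs v. r v u}. F u v)"
    proof (rule sum.union_disjoint)
      show "{u\<in>nbrs v. r u v} \<inter> {u\<in>nbrs v. r v u} = {}" using r' by auto
    qed auto
    finally show "(\<Sum>u\<in>nbrs v. F u v) = (\<Sum>u\<in>{u\<in>nbrs v. r u v}. F u v) + (\<Sum>u\<in>{u\<in>nbrs v. r v u}. F u v)" .
  qed
  also have "\<dots> = (\<Sum>v\<in>V. \<Sum>u\<in>{u\<in>nbrs v. r u v}. F u v) + (\<Sum>v\<in>V. \<Sum>u\<in>{u\<in>nbrs v. r v u}. F u v)"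
    by (rule sum.distrib)
  also have "(\<Sum>v\<in>V. \<Sum>u\<in>{u\<in>nbrs v. r v u}. F u v) = (\<Sum>v\<in>V. \<Sum>u\<in>V. if u \<in> nbrs v \<and> r v u then F u v else 0)"
    by (simp only: *[of _ "\<lambda>u v. r v u"])
  also have "\<dots> = (\<Sum>u\<in>V. \<Sum>v\<in>V. if u \<in> nbrs v \<and> r v u then F u v else 0)"
    by (rule sum.swap)
  also have "\<dots> = (\<Sum>v\<in>V. \<Sum>u\<in>V. if u \<in> nbrs v \<and> r u v then F u v else 0)"
  proof (intro sum.cong refl)
    fix u v
    have "u \<in> nbrs v \<longleftrightarrow> v \<in> nbrs u" by (rule nbrs_sym)
    then show "(if v \<in> nbrs u \<and> r u v then F v u else 0) = (if u \<in> nbrs v \<and> r u v then F u v else 0)"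
      by (simp add: sym[of v u])
  qed
  also have "\<dots> = (\<Sum>v\<in>V. \<Sum>u\<in>{u\<in>nbrs v. r u v}. F u v)" by (simp only: *[of _ r])
  finally show ?thesis by simp
qed

lemma precedes_xor: "u \<noteq> v \<Longrightarrow> precedes u v \<longleftrightarrow> \<not> precedes v u"
  unfolding precedes_def by auto

lemma sum_back_nbrs:
  fixes F :: "'a \<Rightarrow> 'a \<Rightarrow> real"
  assumes "\<And>u v. F u v = F v u"
  shows "2 * (\<Sum>v\<in>V. \<Sum>u\<in>back_nbrs v. F u v) = (\<Sum>v\<in>V. \<Sum>u\<in>nbrs v. F u v)"
  unfolding back_nbrs_def by (rule orient_sum[OF assms precedes_xor])

lemma sum_less:
  fixes F :: "'a \<Rightarrow> 'a \<Rightarrow> real"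
  assumes "\<And>u v. F u v = F v u"
  shows "2 * (\<Sum>v\<in>V. \<Sum>u\<in>{u\<in>nbrs v. u < v}. F u v) = (\<Sum>v\<in>V. \<Sum>u\<in>nbrs v. F u v)"
  by (rule orient_sum) (use assms in auto)

lemma handshake: "(\<Sum>v\<in>V. real (deg v)) = 2 * m"
proof -
  define I where "I = (SIGMA v:V. {u\<in>nbrs v. u < v})"
  have "bij_betw (\<lambda>(v, u). {u, v}) I (edges G)"
  proof (rule bij_betw_imageI)
    show "inj_on (\<lambda>(v, u). {u, v}) I" by (auto simp: inj_on_def I_def doubleton_eq_iff)
    show "(\<lambda>(v, u). {u, v}) ` I = edges G"
    proof
      show "(\<lambda>(v, u). {u, v}) ` I \<subseteq> edges G" by (auto simp: I_def nbrs_def)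
      show "edges G \<subseteq> (\<lambda>(v, u). {u, v}) ` I"
      proof
        fix e assume e: "e \<in> edges G"
        with simple have "card e = 2" by (auto simp: simple_graph_def)
        then obtain a b where ab: "e = {a, b}" "a \<noteq> b" by (auto simp: card_2_iff)
        define u v where "u = min a b" and "v = max a b"
        have uv: "e = {u, v}" "u < v" using ab unfolding u_def v_def by (auto simp: min_def max_def)
        then have "u \<in> nbrs v" using e by (simp add: nbrs_def)
        then have "(v, u) \<in> I" using uv nbrsD by (auto simp: I_def)
        then show "e \<in> (\<lambda>(v, u). {u, v}) ` I" using uv(1) by force
      qed
    qed
  qed
  then have "card I = card (edges G)" by (rule bij_betw_same_card)
  moreover have "card I = (\<Sum>v\<in>V. card {u\<in>nbrs v. u < v})" unfolding I_def by (subst card_SigmaI) auto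
  ultimately have "m = (\<Sum>v\<in>V. \<Sum>u\<in>{u\<in>nbrs v. u < v}. 1)" by (simp add: m_def flip: of_nat_sum)
  then show ?thesis using sum_less[of "\<lambda>_ _. 1"] by (simp add: deg_def)
qed

lemma sum_card_back_nbrs: "(\<Sum>v\<in>V. real (card (back_nbrs v))) = m"
  using sum_back_nbrs[of "\<lambda>_ _. 1"] handshake by (simp add: deg_def)

lemma card_back_nbrs_le_deg: "card (back_nbrs v) \<le> deg v"
  unfolding deg_def by (rule card_mono) (auto simp: back_nbrs_def)

text \<open>If \<open>v\<close> has \<open>b\<close> neighbours that precede it, then all of them have degree at least
  \<open>deg v \<ge> b\<close>, so that \<open>b\<^sup>2\<close> is at most the sum of all degrees.\<close>

lemma card_back_nbrs_bound: "real (card (back_nbrs v)) \<le> sqrt (2 * m)"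
proof (rule real_le_rsqrt)
  have "real (card (back_nbrs v)) * real (card (back_nbrs v)) \<le> (\<Sum>u\<in>back_nbrs v. real (deg v))"
    using card_back_nbrs_le_deg[of v] by (simp add: mult_left_mono)
  also have "\<dots> \<le> (\<Sum>u\<in>back_nbrs v. real (deg u))"
    by (intro sum_mono) (auto simp: back_nbrs_def precedes_def)
  also have "\<dots> \<le> (\<Sum>u\<in>V. real (deg u))"
    by (rule sum_mono2) (use nbrsD in \<open>auto simp: back_nbrs_def\<close>)
  finally show "(real (card (back_nbrs v)))\<^sup>2 \<le> 2 * m" by (simp add: handshake power2_eq_square)
qed

definition T :: "('a \<Rightarrow> nat) \<Rightarrow> real" where "T X = (\<Sum>v\<in>V. star_sum (back_nbrs v) v X)"

lemma two_T: "2 * T X = (\<Sum>v\<in>V. star_sum (nbrs v) v X)"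
  unfolding T_def star_sum_def by (rule sum_back_nbrs) (simp add: Y_commute)

text \<open>Subtracting the star at \<open>v\<close> removes precisely the edges that meet \<open>v\<close>.\<close>

lemma T_minus_star_free:
  assumes v: "v \<in> V"
  shows "T (X(v := a)) - star_sum (nbrs v) v (X(v := a)) = T X - star_sum (nbrs v) v X"
proof -
  \<comment> \<open>Every edge is counted twice, so the ordered pairs that avoid \<open>v\<close> remain.\<close>
  have *: "2 * T X - 2 * star_sum (nbrs v) v X = (\<Sum>k\<in>V - {v}. \<Sum>u\<in>nbrs k - {v}. Y u k X)" for X
  proof -
    have "2 * T X = star_sum (nbrs v) v X + (\<Sum>k\<in>V - {v}. star_sum (nbrs k) k X)"
      unfolding two_T using v by (simp add: sum.remove)
    also have "(\<Sum>k\<in>V - {v}. star_sum (nbrs k) k X)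
       = (\<Sum>k\<in>V - {v}. (if k \<in> nbrs v then Y k v X else 0) + (\<Sum>u\<in>nbrs k - {v}. Y u k X))"
    proof (intro sum.cong refl)
      fix k assume "k \<in> V - {v}"
      show "star_sum (nbrs k) k X = (if k \<in> nbrs v then Y k v X else 0) + (\<Sum>u\<in>nbrs k - {v}. Y u k X)"
      proof (cases "k \<in> nbrs v")
        case True
        then have "v \<in> nbrs k" by (simp add: nbrs_sym)
        then show ?thesis using True by (simp add: star_sum_def sum.remove Y_commute[of v k])
      next
        case False
        then have "v \<notin> nbrs k" using nbrs_sym by blast
        then show ?thesis using False by (simp add: star_sum_def)
      qed
    qed
    also have "\<dots> = (\<Sum>k\<in>V - {v}. if k \<in> nbrs v then Y k v X else 0) + (\<Sum>k\<in>V - {v}. \<Sum>u\<in>nbrs k - {v}. Y u k X)"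
      by (rule sum.distrib)
    also have "(\<Sum>k\<in>V - {v}. if k \<in> nbrs v then Y k v X else 0) = star_sum (nbrs v) v X"
      unfolding star_sum_def using nbrsD by (subst sum.inter_filter[symmetric]) (auto intro!: sum.cong)
    finally show ?thesis by simp
  qed
  have "2 * T (X(v := a)) - 2 * star_sum (nbrs v) v (X(v := a)) = 2 * T X - 2 * star_sum (nbrs v) v X"
    unfolding * by (intro sum.cong refl) auto
  then show ?thesis by simp
qed

lemma expect_sum_square:
  assumes "finite I"
  shows "expect (\<lambda>X. (\<Sum>i\<in>I. r i X)\<^sup>2) = (\<Sum>i\<in>I. \<Sum>j\<in>I. expect (\<lambda>X. r i X * r j X))"
  by (simp add: power2_eq_square sum_product)

text \<open>Summands with different keys are orthogonal and each key occurs at most \<open>k\<close> times, so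
  the square of the sum has at most \<open>card I * k\<close> contributing products.\<close>

lemma expect_sum_square_le:
  fixes s :: real and k :: nat
  assumes I: "finite I"
    and orth: "\<And>i j. i \<in> I \<Longrightarrow> j \<in> I \<Longrightarrow> key i \<noteq> key j \<Longrightarrow> expect (\<lambda>X. r i X * r j X) = 0"
    and fib: "\<And>i. i \<in> I \<Longrightarrow> card {j\<in>I. key j = key i} \<le> k"
    and s: "\<And>i. i \<in> I \<Longrightarrow> expect (\<lambda>X. (r i X)\<^sup>2) \<le> s" and s0: "s \<ge> 0"
  shows "expect (\<lambda>X. (\<Sum>i\<in>I. r i X)\<^sup>2) \<le> card I * (k * s)"
proof -
  have "(\<Sum>j\<in>I. expect (\<lambda>X. r i X * r j X)) \<le> k * s" if i: "i \<in> I" for i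
  proof -
    have "(\<Sum>j\<in>I. expect (\<lambda>X. r i X * r j X)) \<le> (\<Sum>j\<in>I. if key j = key i then s else 0)"
    proof (rule sum_mono)
      fix j assume j: "j \<in> I"
      have "expect (\<lambda>X. r i X * r j X) \<le> expect (\<lambda>X. ((r i X)\<^sup>2 + (r j X)\<^sup>2) / 2)"
      proof (rule expect_mono)
        fix X
        show "r i X * r j X \<le> ((r i X)\<^sup>2 + (r j X)\<^sup>2) / 2"
          using sum_squares_bound[of "r i X" "r j X"] by simp
      qed
      also have "\<dots> \<le> s" using s[OF i] s[OF j] by simp
      finally show "expect (\<lambda>X. r i X * r j X) \<le> (if key j = key i then s else 0)"
        using orth[OF i j] by auto
    qed
    also have "\<dots> = card {j\<in>I. key j = key i} * s"
      using I by (simp add: sum.inter_filter[symmetric])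
    also have "\<dots> \<le> k * s" using fib[OF i] s0 by (intro mult_right_mono) auto
    finally show ?thesis .
  qed
  then have "(\<Sum>i\<in>I. \<Sum>j\<in>I. expect (\<lambda>X. r i X * r j X)) \<le> (\<Sum>i\<in>I. k * s)" by (rule sum_mono)
  then show ?thesis unfolding expect_sum_square[OF I] by simp
qed

lemma expect_T: "expect T = 0"
  unfolding T_def[abs_def] 
proof (simp, intro sum.neutral ballI)
  fix v assume "v \<in> V"
  then show "expect (star_sum (back_nbrs v) v) = 0"
    using nbrsD by (intro star_sum_moments(1)) (auto simp: back_nbrs_def)
qed

lemma expect_T2: "expect (\<lambda>X. (T X)\<^sup>2) = m * q"
proof -
  define I where "I = Sigma V back_nbrs"
  have I: "finite I" unfolding I_def by auto
  have back_nbrsD: "u \<in> V" "u \<noteq> v" "precedes u v" if "u \<in> back_nbrs v" for u v 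
    using that nbrsD by (auto simp: back_nbrs_def)
  have T: "T X = (\<Sum>i\<in>I. Y (snd i) (fst i) X)" for X
    unfolding T_def star_sum_def I_def by (subst sum.Sigma) (auto simp: split_def)
  have "(\<Sum>j\<in>I. expect (\<lambda>X. Y (snd i) (fst i) X * Y (snd j) (fst j) X)) = q" if i: "i \<in> I" for i
  proof -
    have "expect (\<lambda>X. Y (snd i) (fst i) X * Y (snd j) (fst j) X) = (if j = i then q else 0)" if j: "j \<in> I" for j
    proof (cases "j = i")
      case True
      then show ?thesis using expect_Y2[of "snd i" "fst i"] i back_nbrsD(1,2) unfolding I_def 
        by (auto simp: power2_eq_square)
    next
      case False
      obtain v u v' u' where ij: "i = (v, u)" "j = (v', u')" by (cases i, cases j) auto
      have uv: "v \<in> V" "u \<in> back_nbrs v" "v' \<in> V" "u' \<in> back_nbrs v'" using i j ij unfolding I_def by auto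
      have "{u, v} \<noteq> {u', v'}"
        using False ij back_nbrsD[OF uv(2)] back_nbrsD[OF uv(4)] precedes_xor[of u v] by (auto simp: doubleton_eq_iff)
      then show ?thesis using False ij uv expect_YY[of u v u' v'] back_nbrsD by auto
    qed
    then have "(\<Sum>j\<in>I. expect (\<lambda>X. Y (snd i) (fst i) X * Y (snd j) (fst j) X)) = (\<Sum>j\<in>I. if j = i then q else 0)"
      by (rule sum.cong[OF refl])
    then show ?thesis using I i by simp
  qed
  then have "expect (\<lambda>X. (T X)\<^sup>2) = card I * q"
    unfolding T expect_sum_square[OF I] by simp
  moreover have "real (card I) = m" unfolding I_def by (subst card_SigmaI) (auto simp: sum_card_back_nbrs)
  ultimately show ?thesis by simp
qed

text \<open>Triples \<open>(v, u, w)\<close> that stand for the path \<open>u - v - w\<close> whose first edge is oriented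
  into \<open>v\<close>.\<close>

definition paths :: "('a \<times> 'a \<times> 'a) set" where
  "paths = (SIGMA v:V. SIGMA u:back_nbrs v. nbrs v - {u})"

lemma fin_paths[simp, intro]: "finite paths" unfolding paths_def by auto

lemma pathsD:
  assumes "(v, u, w) \<in> paths"
  shows "u \<in> nbrs v" "w \<in> nbrs v" "u \<noteq> w" "u \<in> V" "v \<in> V" "w \<in> V" "u \<noteq> v" "w \<noteq> v"
proof -
  show 1: "u \<in> nbrs v" "w \<in> nbrs v" "u \<noteq> w" using assms by (auto simp: paths_def back_nbrs_def)
  show "u \<in> V" "v \<in> V" "w \<in> V" "u \<noteq> v" "w \<noteq> v" using nbrsD[OF 1(1)] nbrsD[OF 1(2)] by auto
qed

text \<open>The second place where the orientation matters: without it, stars would have of order \<open>m\<^sup>2\<close>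
  such paths.\<close>

lemma card_paths: "real (card paths) \<le> 2 * m * sqrt (2 * m)"
proof -
  have "card paths = (\<Sum>v\<in>V. \<Sum>u\<in>back_nbrs v. card (nbrs v - {u}))"
    unfolding paths_def by (simp add: card_SigmaI)
  also have "\<dots> \<le> (\<Sum>v\<in>V. \<Sum>u\<in>back_nbrs v. deg v)"
    unfolding deg_def by (intro sum_mono card_mono) auto
  finally have "real (card paths) \<le> (\<Sum>v\<in>V. real (card (back_nbrs v)) * real (deg v))"
    by (simp flip: of_nat_mult of_nat_sum)
  also have "\<dots> \<le> (\<Sum>v\<in>V. sqrt (2 * m) * real (deg v))"
    by (intro sum_mono mult_right_mono card_back_nbrs_bound) auto
  also have "\<dots> = sqrt (2 * m) * (2 * m)" unfolding sum_distrib_left[symmetric] handshake ..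
  finally show ?thesis by (simp add: mult.commute)
qed

section \<open>The empirical variance term\<close>

text \<open>Divided by \<open>m * q\<close>, this is the random variable whose closeness to \<open>1\<close> Stein's method
  requires.\<close>

definition cross_sum :: "('a \<Rightarrow> nat) \<Rightarrow> real" where
  "cross_sum X = (\<Sum>v\<in>V. star_sum (back_nbrs v) v X * star_sum (nbrs v) v X)"

text \<open>The product along a path minus its projection obtained by averaging over the middle vertex. It
  is completely degenerate, that is, it averages out over each of its three vertices.\<close>

definition path_remainder :: "'a \<times> 'a \<times> 'a \<Rightarrow> ('a \<Rightarrow> nat) \<Rightarrow> real" where
  "path_remainder = (\<lambda>(v, u, w) X. Y u v X * Y w v X - p * Y u w X)"

text \<open>Times \<open>p\<close>, this is the projection of the product along the path \<open>u - v - w\<close> obtained by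
  averaging over the colour of \<open>v\<close>.\<close>

definition path_ends :: "'a \<times> 'a \<times> 'a \<Rightarrow> ('a \<Rightarrow> nat) \<Rightarrow> real" where
  "path_ends = (\<lambda>(v, u, w) X. Y u w X)"

text \<open>The diagonal terms \<open>(Y u v)\<^sup>2\<close> are linear in \<open>Y u v\<close> by \<open>Y_square\<close> and contribute the mean
  and a multiple of \<open>T\<close>; each off-diagonal term is split into its projection and a
  degenerate remainder.\<close>

lemma cross_sum_decomposition:
  "cross_sum X - m * q = (1 - 2 * p) * T X + p * (\<Sum>i\<in>paths. path_ends i X) + (\<Sum>i\<in>paths. path_remainder i X)"
proof -
  have "cross_sum X = (\<Sum>v\<in>V. \<Sum>u\<in>back_nbrs v. \<Sum>w\<in>nbrs v. Y u v X * Y w v X)"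
    unfolding cross_sum_def star_sum_def by (simp add: sum_product)
  also have "\<dots> = (\<Sum>v\<in>V. \<Sum>u\<in>back_nbrs v. (Y u v X)\<^sup>2 + (\<Sum>w\<in>nbrs v - {u}. Y u v X * Y w v X))"
  proof (intro sum.cong refl)
    fix v u assume "u \<in> back_nbrs v"
    then have "u \<in> nbrs v" using back_nbrs_subset by blast
    then show "(\<Sum>w\<in>nbrs v. Y u v X * Y w v X) = (Y u v X)\<^sup>2 + (\<Sum>w\<in>nbrs v - {u}. Y u v X * Y w v X)"
      by (simp add: sum.remove power2_eq_square)
  qed
  also have "\<dots> = (\<Sum>v\<in>V. \<Sum>u\<in>back_nbrs v. (Y u v X)\<^sup>2) + (\<Sum>v\<in>V. \<Sum>u\<in>back_nbrs v. \<Sum>w\<in>nbrs v - {u}. Y u v X * Y w v X)"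
    by (simp add: sum.distrib)
  also have "(\<Sum>v\<in>V. \<Sum>u\<in>back_nbrs v. (Y u v X)\<^sup>2) = (1 - 2 * p) * T X + m * q"
    unfolding Y_square sum.distrib T_def star_sum_def sum_distrib_left[symmetric]
    by (simp add: sum_distrib_right[symmetric] sum_card_back_nbrs)
  also have "(\<Sum>v\<in>V. \<Sum>u\<in>back_nbrs v. \<Sum>w\<in>nbrs v - {u}. Y u v X * Y w v X) = (\<Sum>(v, u, w)\<in>paths. Y u v X * Y w v X)"
    unfolding paths_def by (simp add: sum.Sigma split_def)
  also have "\<dots> = (\<Sum>i\<in>paths. p * path_ends i X + path_remainder i X)"
    by (intro sum.cong) (auto simp: path_ends_def path_remainder_def)
  also have "\<dots> = p * (\<Sum>i\<in>paths. path_ends i X) + (\<Sum>i\<in>paths. path_remainder i X)"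
    by (simp add: sum.distrib sum_distrib_left)
  finally show ?thesis by simp
qed

lemma resample_mean_diff: "resample_mean v (\<lambda>X. g X - h X) X = resample_mean v g X - resample_mean v h X"
  by (simp add: resample_mean_def sum_subtractf diff_divide_distrib)

lemma resample_mean_cmult: "resample_mean v (\<lambda>X. k * g X) X = k * resample_mean v g X"
  by (simp add: resample_mean_def sum_distrib_left)

lemma resample_mean_mult_free: "(\<And>X a. h (X(v := a)) = h X) \<Longrightarrow> resample_mean v (\<lambda>X. g X * h X) X = resample_mean v g X * h X"
  by (simp add: resample_mean_def sum_distrib_right)

lemma resample_mean_path_remainder:
  assumes vuw: "(v, u, w) \<in> paths" and z: "z \<in> {v, u, w}" and X: "X \<in> \<Omega>"
  shows "resample_mean z (path_remainder (v, u, w)) X = 0"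
proof -
  note d = pathsD[OF vuw]
  consider "z = v" | "z = u" | "z = w" using z by auto
  then show ?thesis
  proof cases
    case 1
    have "resample_mean v (Y u w) X = Y u w X" using d c2 by (simp add: resample_mean_def)
    then show ?thesis using 1 d X by (simp add: path_remainder_def resample_mean_diff resample_mean_cmult resample_mean_YY)
  next
    case 2
    have "resample_mean u (\<lambda>X. Y u v X * Y w v X) X = resample_mean u (Y u v) X * Y w v X"
      by (rule resample_mean_mult_free) (use d in auto)
    then show ?thesis using 2 d X by (simp add: path_remainder_def resample_mean_diff resample_mean_cmult resample_mean_Y')
  next
    case 3
    have "resample_mean w (\<lambda>X. Y w v X * Y u v X) X = resample_mean w (Y w v) X * Y u v X"
      by (rule resample_mean_mult_free) (use d in auto)
    then show ?thesis using 3 d X by (simp add: path_remainder_def resample_mean_diff resample_mean_cmult resample_mean_Y resample_mean_Y' mult.commute)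
  qed
qed

text \<open>By degeneracy two remainders are orthogonal unless they live on the same three vertices, and a
  set of three vertices carries at most \<open>3 ^ 3\<close> triples.\<close>

lemma expect_path_remainder_sum: "expect (\<lambda>X. (\<Sum>i\<in>paths. path_remainder i X)\<^sup>2) \<le> card paths * (27 * (4 * p\<^sup>2))"
proof -
  define key where "key = (\<lambda>(v, u, w). {v, u, w} :: 'a set)"
  have key3: "card {v, u, w} = 3" if "(v, u, w) \<in> paths" for v u w
  proof -
    have "v \<notin> {u, w}" "u \<notin> {w}" using pathsD[OF that] by auto
    then show ?thesis by simp
  qed
  have "expect (\<lambda>X. (\<Sum>i\<in>paths. path_remainder i X)\<^sup>2) \<le> card paths * (real 27 * (4 * p\<^sup>2))"
  proof (rule expect_sum_square_le[where key=key])
    fix i j assume i: "i \<in> paths" and j: "j \<in> paths" and k: "key i \<noteq> key j"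
    obtain v u w v' u' w' where ij: "i = (v, u, w)" "j = (v', u', w')" by (cases i, cases j) auto
    have "card (key i) = 3" "card (key j) = 3"
      using key3[OF i[unfolded ij]] key3[OF j[unfolded ij]] by (simp_all only: ij key_def prod.case)
    moreover have "finite (key j)" by (simp add: key_def ij)
    ultimately have "\<not> key i \<subseteq> key j" using k card_subset_eq[of "key j" "key i"] by auto
    then obtain z where z: "z \<in> key i" "z \<notin> key j" by blast
    show "expect (\<lambda>X. path_remainder i X * path_remainder j X) = 0"
    proof (rule expect_orthogonal[of z])
      show "z \<in> V" using z(1) pathsD(4-6)[OF i[unfolded ij]] unfolding ij key_def by auto
      show "resample_mean z (path_remainder i) X = 0" if "X \<in> \<Omega>" for X
        using resample_mean_path_remainder[OF i[unfolded ij] _ that, of z] z(1) unfolding ij key_def by simp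
      show "path_remainder j (X(z := a)) = path_remainder j X" for X a
        using z(2) unfolding ij key_def path_remainder_def by simp
    qed
  next
    fix i assume i: "i \<in> paths"
    obtain v u w where vuw: "i = (v, u, w)" by (cases i) auto
    note d = pathsD[OF i[unfolded vuw]]
    have "card (key i) = 3" unfolding vuw key_def prod.case by (rule key3[OF i[unfolded vuw]])
    have "finite (key i)" by (simp add: vuw key_def)
    moreover have "{j\<in>paths. key j = key i} \<subseteq> key i \<times> key i \<times> key i"
    proof
      fix j assume "j \<in> {j\<in>paths. key j = key i}"
      then have "key i = key j" by simp
      moreover have "j \<in> key j \<times> key j \<times> key j" by (cases j) (simp add: key_def)
      ultimately show "j \<in> key i \<times> key i \<times> key i" by simp
    qed
    ultimately have "card {j\<in>paths. key j = key i} \<le> card (key i \<times> key i \<times> key i)"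
      by (intro card_mono) simp_all
    also have "\<dots> = 27" by (simp add: card_cartesian_product \<open>card (key i) = 3\<close>)
    finally show "card {j\<in>paths. key j = key i} \<le> 27" .
    have "expect (\<lambda>X. (path_remainder i X)\<^sup>2) \<le> expect (\<lambda>X. 2 * ((Y u v X)\<^sup>2 * (Y w v X)\<^sup>2) + 2 * p\<^sup>2 * (Y u w X)\<^sup>2)"
    proof (rule expect_mono)
      fix X
      have "(a - b)\<^sup>2 \<le> 2 * a\<^sup>2 + 2 * b\<^sup>2" for a b :: real
        using sum_squares_bound[of a "- b"] by (simp add: power2_eq_square algebra_simps)
      from this[of "Y u v X * Y w v X" "p * Y u w X"]
      show "(path_remainder i X)\<^sup>2 \<le> 2 * ((Y u v X)\<^sup>2 * (Y w v X)\<^sup>2) + 2 * p\<^sup>2 * (Y u w X)\<^sup>2"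
        by (simp add: path_remainder_def vuw power_mult_distrib)
    qed
    also have "\<dots> = 2 * expect (\<lambda>X. (Y u v X)\<^sup>2 * (Y w v X)\<^sup>2) + 2 * p\<^sup>2 * q"
      using d expect_Y2[of u w] by simp
    also have "expect (\<lambda>X. (Y u v X)\<^sup>2 * (Y w v X)\<^sup>2) = q * q"
    proof -
      have "expect (\<lambda>X. (Y u v X)\<^sup>2 * (Y w v X)\<^sup>2) 
         = expect (\<lambda>X. (1 - 2 * p) * (Y v u X * (Y w v X)\<^sup>2) + q * (Y w v X)\<^sup>2)"
        by (intro expect_cong) (simp add: Y_square[of u v] algebra_simps Y_commute[of v u])
      also have "\<dots> = q * q"
        using expect_Y_times[of v u "\<lambda>X. (Y w v X)\<^sup>2"] expect_Y2[of w v] d by simp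
      finally show ?thesis .
    qed
    also have "2 * (q * q) + 2 * p\<^sup>2 * q \<le> 2 * (p * p) + 2 * p\<^sup>2 * 1"
      using p_bounds by (intro add_mono mult_mono) auto
    finally show "expect (\<lambda>X. (path_remainder i X)\<^sup>2) \<le> 4 * p\<^sup>2" by (simp add: power2_eq_square)
  qed auto
  then show ?thesis by simp
qed

text \<open>Tuples \<open>(u, v, w, v')\<close> of the corners of a 4-cycle in cyclic order.\<close>

definition c4_tuples :: "('a \<times> 'a \<times> 'a \<times> 'a) set" where
  "c4_tuples = {(u, v, w, v'). u \<noteq> w \<and> v \<noteq> v' \<and> u \<in> nbrs v \<and> w \<in> nbrs v \<and> u \<in> nbrs v' \<and> w \<in> nbrs v'}"

lemma fin_c4_tuples[simp, intro]: "finite c4_tuples"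
  by (rule finite_subset[of _ "V \<times> V \<times> V \<times> V"]) (auto simp: c4_tuples_def dest: nbrsD)

text \<open>A tuple determines a copy of the cycle, and at most \<open>4 ^ 4\<close> tuples have their entries
  among the four vertices of a given copy.\<close>

lemma card_c4_tuples: "card c4_tuples \<le> 256 * num_copies (cycle_graph 4) G"
proof -
  define C where "C = {S. subgraph S G \<and> graph_iso (cycle_graph 4) S}"
  have finC: "finite C"
  proof (rule finite_subset)
    show "C \<subseteq> Pow V \<times> Pow (edges G)" by (auto simp: C_def subgraph_def verts_def edges_def)
  qed (simp add: finite_cartesian_product)
  have card4: "card (verts S) = 4" "finite (verts S)" if S: "S \<in> C" for S
  proof -
    obtain f where "bij_betw f (verts (cycle_graph 4)) (verts S)"
      using S by (auto simp: C_def graph_iso_def)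
    then have "card (verts S) = card {0..<4::nat}"
      by (simp add: bij_betw_same_card[symmetric] cycle_graph_def verts_def)
    then show "card (verts S) = 4" by simp
    then show "finite (verts S)" by (metis card.infinite zero_neq_numeral)
  qed
  have "c4_tuples \<subseteq> (\<Union>S\<in>C. verts S \<times> verts S \<times> verts S \<times> verts S)"
  proof
    fix t assume "t \<in> c4_tuples"
    then obtain u v w v' where t: "t = (u, v, w, v')" "u \<noteq> w" "v \<noteq> v'" "u \<in> nbrs v" "w \<in> nbrs v" "u \<in> nbrs v'" "w \<in> nbrs v'"
      by (auto simp: c4_tuples_def)
    define S where "S = ({u, v, w, v'}, {{u, v}, {v, w}, {w, v'}, {v', u}})"
    have d: "u \<noteq> v" "w \<noteq> v" "u \<noteq> v'" "w \<noteq> v'" "u \<in> V" "v \<in> V" "w \<in> V" "v' \<in> V" using t nbrsD by blast+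
    have vS: "verts S = {u, v, w, v'}" and eS: "edges S = {{u, v}, {v, w}, {w, v'}, {v', u}}"
      by (simp_all add: S_def verts_def edges_def)
    have "v' \<in> nbrs u" "v \<in> nbrs w" by (rule iffD1[OF nbrs_sym t(6)], rule iffD1[OF nbrs_sym t(5)])
    then have "{u, v} \<in> edges G" "{v, w} \<in> edges G" "{w, v'} \<in> edges G" "{v', u} \<in> edges G"
      using t(4-7) by (simp_all add: nbrs_def)
    then have "edges S \<subseteq> edges G" by (simp add: eS)
    moreover have "simple_graph S" unfolding simple_graph_def vS eS using d by simp
    moreover have "verts S \<subseteq> V" using d by (simp add: vS)
    ultimately have "subgraph S G" by (simp add: subgraph_def)
    moreover have "graph_iso (cycle_graph 4) S"
    proof -
      define f where "f n = (if n = 0 then u else if n = 1 then v else if n = 2 then w else v')" for n :: nat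
      have V4: "verts (cycle_graph 4) = {0, 1, 2, 3}" by (auto simp: cycle_graph_def verts_def)
      have E4: "edges (cycle_graph 4) = {{0, 1}, {1, 2}, {2, 3}, {3, 0}}"
      proof -
        have "edges (cycle_graph 4) = (\<lambda>i. {i, (i + 1) mod 4}) ` {i. i < 4}"
          unfolding cycle_graph_def edges_def snd_conv by (rule setcompr_eq_image)
        also have "{i. i < 4} = {0, 1, 2, 3 :: nat}" by auto
        finally have "edges (cycle_graph 4) = (\<lambda>i. {i, (i + 1) mod 4}) ` {0, 1, 2, 3}" .
        moreover have "(0 + 1) mod 4 = (1::nat)" "(1 + 1) mod 4 = (2::nat)" "(2 + 1) mod 4 = (3::nat)"
          "(3 + 1) mod 4 = (0::nat)" by simp_all
        ultimately show ?thesis by (simp only: image_insert image_empty)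
      qed
      have "inj_on f {0, 1, 2, 3}" unfolding inj_on_def f_def using t(2,3) d by simp
      moreover have "f ` {0, 1, 2, 3} = verts S" unfolding vS f_def by auto
      ultimately have "bij_betw f (verts (cycle_graph 4)) (verts S)"
        unfolding V4 bij_betw_def by simp
      moreover have "edges S = (\<lambda>e. f ` e) ` edges (cycle_graph 4)"
        unfolding E4 eS f_def by (simp add: insert_commute)
      ultimately show ?thesis unfolding graph_iso_def by blast
    qed
    ultimately have "S \<in> C" by (simp add: C_def)
    moreover have "t \<in> verts S \<times> verts S \<times> verts S \<times> verts S" by (simp add: t(1) vS)
    ultimately show "t \<in> (\<Union>S\<in>C. verts S \<times> verts S \<times> verts S \<times> verts S)" by blast
  qed
  then have "card c4_tuples \<le> card (\<Union>S\<in>C. verts S \<times> verts S \<times> verts S \<times> verts S)"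
    using finC card4 by (intro card_mono) auto
  also have "\<dots> \<le> (\<Sum>S\<in>C. card (verts S \<times> verts S \<times> verts S \<times> verts S))" by (rule card_UN_le[OF finC])
  also have "\<dots> = (\<Sum>S\<in>C. 256)" by (intro sum.cong) (auto simp: card_cartesian_product card4)
  finally show ?thesis by (simp add: num_copies_def C_def)
qed

text \<open>Two paths contribute only if they have the same end points. Either their centres agree as
  well, which leaves two possibilities for the second path, or the two centres and
  the end points form a 4-cycle.\<close>

lemma expect_path_ends_sum:
  "expect (\<lambda>X. (\<Sum>i\<in>paths. path_ends i X)\<^sup>2) \<le> q * (2 * card paths + 2 * card c4_tuples)"
proof -
  \<comment> \<open>Pairs of paths with the same end points: \<open>f1\<close>, \<open>f2\<close> produce those with equal centres and \<open>g1\<close>, \<open>g2\<close> the others.\<close>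
  define K where "K = {((v, u, w), (v', u', w')) | v u w v' u' w'. 
    (v, u, w) \<in> paths \<and> (v', u', w') \<in> paths \<and> {u, w} = {u', w'}}"
  define f1 f2 where "f1 = (\<lambda>(v, u, w). ((v, u, w :: 'a), (v :: 'a, u :: 'a, w)))" and "f2 = (\<lambda>(v, u, w). ((v, u, w), (v :: 'a, w :: 'a, u :: 'a)))"
  define g1 g2 where "g1 = (\<lambda>(u, v, w, v'). ((v :: 'a, u, w), (v' :: 'a, u :: 'a, w :: 'a)))"
    and "g2 = (\<lambda>(u, v, w, v'). ((v :: 'a, u, w), (v' :: 'a, w :: 'a, u :: 'a)))"
  have K: "K \<subseteq> (f1 ` paths \<union> f2 ` paths) \<union> (g1 ` c4_tuples \<union> g2 ` c4_tuples)"
  proof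
    fix k assume "k \<in> K"
    then obtain v u w v' u' w' where k: "k = ((v, u, w), (v', u', w'))" "(v, u, w) \<in> paths" "(v', u', w') \<in> paths"
      "{u, w} = {u', w'}" unfolding K_def by auto
    note d = pathsD[OF k(2)] note d' = pathsD[OF k(3)]
    show "k \<in> (f1 ` paths \<union> f2 ` paths) \<union> (g1 ` c4_tuples \<union> g2 ` c4_tuples)"
    proof (cases "v' = v")
      case True
      have "k = f1 (v, u, w) \<or> k = f2 (v, u, w)"
        using k(1,4) True by (auto simp: f1_def f2_def doubleton_eq_iff)
      then show ?thesis using k(2) by blast
    next
      case False
      have "(u, v, w, v') \<in> c4_tuples" using d d' k(4) False by (auto simp: c4_tuples_def doubleton_eq_iff)
      moreover have "k = g1 (u, v, w, v') \<or> k = g2 (u, v, w, v')"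
        using k(1,4) by (auto simp: g1_def g2_def doubleton_eq_iff)
      ultimately show ?thesis by blast
    qed
  qed
  have finK: "finite K" by (rule finite_subset[OF K]) auto
  have "card K \<le> card ((f1 ` paths \<union> f2 ` paths) \<union> (g1 ` c4_tuples \<union> g2 ` c4_tuples))"
    by (rule card_mono[OF _ K]) auto
  also have "\<dots> \<le> (card (f1 ` paths) + card (f2 ` paths)) + (card (g1 ` c4_tuples) + card (g2 ` c4_tuples))"
    by (meson card_Un_le add_mono order_trans)
  also have "\<dots> \<le> (card paths + card paths) + (card c4_tuples + card c4_tuples)"
    by (intro add_mono card_image_le) auto
  finally have cK: "card K \<le> 2 * card paths + 2 * card c4_tuples" by simp
  have "expect (\<lambda>X. (\<Sum>i\<in>paths. path_ends i X)\<^sup>2) = (\<Sum>i\<in>paths. \<Sum>j\<in>paths. expect (\<lambda>X. path_ends i X * path_ends j X))"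
    by (rule expect_sum_square) auto
  also have "\<dots> \<le> (\<Sum>i\<in>paths. \<Sum>j\<in>paths. if (i, j) \<in> K then q else 0)"
  proof (intro sum_mono)
    fix i j assume i: "i \<in> paths" and j: "j \<in> paths"
    obtain v u w v' u' w' where ij: "i = (v, u, w)" "j = (v', u', w')" by (cases i, cases j) auto
    note d = pathsD[OF i[unfolded ij]] note d' = pathsD[OF j[unfolded ij]]
    show "expect (\<lambda>X. path_ends i X * path_ends j X) \<le> (if (i, j) \<in> K then q else 0)"
    proof (cases "{u, w} = {u', w'}")
      case True
      then have "Y u' w' = Y u w" by (auto simp: doubleton_eq_iff Y_commute)
      then have "expect (\<lambda>X. path_ends i X * path_ends j X) = q"
        using expect_Y2[of u w] d by (simp add: path_ends_def ij power2_eq_square)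
      moreover have "(i, j) \<in> K" using True i j by (auto simp: K_def ij)
      ultimately show ?thesis by simp
    next
      case False
      then have "expect (\<lambda>X. path_ends i X * path_ends j X) = 0"
        using expect_YY[of u w u' w'] d d' by (simp add: path_ends_def ij)
      then show ?thesis using p_bounds by simp
    qed
  qed
  also have "\<dots> = (\<Sum>k\<in>paths \<times> paths. if k \<in> K then q else 0)"
    by (simp add: sum.cartesian_product split_def)
  also have "\<dots> = card ((paths \<times> paths) \<inter> K) * q"
    by (simp add: sum.inter_restrict[symmetric])
  also have "\<dots> \<le> card K * q"
    using finK p_bounds by (intro mult_right_mono) (auto intro!: card_mono)
  also have "\<dots> \<le> real (2 * card paths + 2 * card c4_tuples) * q"
    using cK p_bounds by (intro mult_right_mono) (auto simp del: of_nat_add of_nat_mult)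
  finally show ?thesis by (simp add: mult.commute)
qed

section \<open>Normal approximation of the number of monochromatic edges\<close>

text \<open>The three parts of the decomposition are estimated separately. The constants are
  \<open>110 = 2 + 27 * 4\<close>, from the projections and the remainders along paths, and
  \<open>512 = 2 * 256\<close>, from the 4-cycles.\<close>

lemma expect_cross_sum_deviation: "expect (\<lambda>X. (cross_sum X - m * q)\<^sup>2)
  \<le> 3 * (m * p + 110 * p\<^sup>2 * (2 * m * sqrt (2 * m)) + 512 * p ^ 3 * num_copies (cycle_graph 4) G)"
proof -
  have m0: "m \<ge> 0" by (simp add: m_def)
  have "expect (\<lambda>X. (cross_sum X - m * q)\<^sup>2) \<le> expect (\<lambda>X. 3 * ((T X)\<^sup>2 + p\<^sup>2 * (\<Sum>i\<in>paths. path_ends i X)\<^sup>2 + (\<Sum>i\<in>paths. path_remainder i X)\<^sup>2))"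
  proof (rule expect_mono)
    fix X
    have sq3: "(a + b + d)\<^sup>2 \<le> 3 * (a\<^sup>2 + b\<^sup>2 + d\<^sup>2)" for a b d :: real
      using sum_squares_bound[of a b] sum_squares_bound[of b d] sum_squares_bound[of a d]
      by (simp add: power2_eq_square algebra_simps)
    have "(cross_sum X - m * q)\<^sup>2 \<le> 3 * (((1 - 2 * p) * T X)\<^sup>2 + (p * (\<Sum>i\<in>paths. path_ends i X))\<^sup>2 + (\<Sum>i\<in>paths. path_remainder i X)\<^sup>2)"
      unfolding cross_sum_decomposition by (rule sq3)
    also have "((1 - 2 * p) * T X)\<^sup>2 \<le> 1 * (T X)\<^sup>2"
      unfolding power_mult_distrib using p_bounds by (intro mult_right_mono) (auto simp: abs_square_le_1)
    finally show "(cross_sum X - m * q)\<^sup>2 \<le> 3 * ((T X)\<^sup>2 + p\<^sup>2 * (\<Sum>i\<in>paths. path_ends i X)\<^sup>2 + (\<Sum>i\<in>paths. path_remainder i X)\<^sup>2)"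
      by (simp add: power_mult_distrib)
  qed
  also have "\<dots> = 3 * (m * q + p\<^sup>2 * expect (\<lambda>X. (\<Sum>i\<in>paths. path_ends i X)\<^sup>2) + expect (\<lambda>X. (\<Sum>i\<in>paths. path_remainder i X)\<^sup>2))"
    by (simp add: expect_T2)
  also have "\<dots> \<le> 3 * (m * p + p\<^sup>2 * (p * (2 * card paths + 512 * num_copies (cycle_graph 4) G)) + card paths * (27 * (4 * p\<^sup>2)))"
  proof -
    have "expect (\<lambda>X. (\<Sum>i\<in>paths. path_ends i X)\<^sup>2) \<le> q * (2 * card paths + 2 * card c4_tuples)" by (rule expect_path_ends_sum)
    also have "\<dots> \<le> p * (2 * card paths + 512 * num_copies (cycle_graph 4) G)"
      using card_c4_tuples p_bounds by (intro mult_mono) auto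
    finally have "p\<^sup>2 * expect (\<lambda>X. (\<Sum>i\<in>paths. path_ends i X)\<^sup>2) \<le> p\<^sup>2 * (p * (2 * card paths + 512 * num_copies (cycle_graph 4) G))"
      by (rule mult_left_mono) simp
    moreover have "m * q \<le> m * p" using p_bounds m0 by (intro mult_left_mono) auto
    ultimately show ?thesis using expect_path_remainder_sum by simp
  qed
  also have "\<dots> \<le> 3 * (m * p + 110 * p\<^sup>2 * card paths + 512 * p ^ 3 * num_copies (cycle_graph 4) G)"
  proof -
    have "p\<^sup>2 * p * card paths \<le> p\<^sup>2 * 1 * card paths"
      using p_bounds by (intro mult_right_mono mult_left_mono) auto
    then show ?thesis by (simp add: algebra_simps power2_eq_square power3_eq_cube)
  qed
  also have "\<dots> \<le> 3 * (m * p + 110 * p\<^sup>2 * (2 * m * sqrt (2 * m)) + 512 * p ^ 3 * num_copies (cycle_graph 4) G)"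
    using card_paths m0 p_bounds by (intro mult_left_mono add_mono) auto
  finally show ?thesis .
qed

text \<open>The Cauchy--Schwarz inequality is applied at each vertex separately. Applied to the centred
  edge indicators one by one it would lose the factor \<open>sqrt b\<close> gained from the cancellation among the \<open>b\<close>
  edges charged to \<open>v\<close>.\<close>

lemma expect_abs_third:
  assumes v: "v \<in> V"
  shows "expect (\<lambda>X. \<bar>star_sum (back_nbrs v) v X * (star_sum (nbrs v) v X)\<^sup>2\<bar>)
    \<le> p * deg v + 2 * p * sqrt p * sqrt (sqrt (2 * m)) * deg v"
proof -
  define b d where "b = real (card (back_nbrs v))" and "d = real (deg v)"
  have bd: "0 \<le> b" "b \<le> d" "b \<le> sqrt (2 * m)" "0 \<le> d"
    using card_back_nbrs_le_deg card_back_nbrs_bound by (auto simp: b_def d_def)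
  have d1: "d = 0 \<or> d \<ge> 1" by (auto simp: d_def)
  have p0: "p \<ge> 0" using p_bounds by simp
  have mom: "expect (\<lambda>X. (star_sum (back_nbrs v) v X)\<^sup>2) = b * q"
    unfolding b_def using v nbrsD by (intro star_sum_moments(2)) (auto simp: back_nbrs_def)
  have mom4: "expect (\<lambda>X. (star_sum (nbrs v) v X) ^ 4) \<le> d * p + 3 * d\<^sup>2 * p\<^sup>2"
    unfolding d_def deg_def using star_sum_moments(3)[of v "nbrs v"] v nbrsD by auto
  have "expect (\<lambda>X. \<bar>star_sum (back_nbrs v) v X * (star_sum (nbrs v) v X)\<^sup>2\<bar>)
    \<le> sqrt (expect (\<lambda>X. (star_sum (back_nbrs v) v X)\<^sup>2)) * sqrt (expect (\<lambda>X. ((star_sum (nbrs v) v X)\<^sup>2)\<^sup>2))"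
    by (rule pmf_cauchy_schwarz) simp
  also have "\<dots> \<le> sqrt (b * p) * sqrt (d * p + 3 * d\<^sup>2 * p\<^sup>2)"
    using mom mom4 p_bounds bd by (intro mult_mono real_sqrt_le_mono) (auto intro!: mult_left_mono)
  also have "\<dots> \<le> sqrt (b * p) * (sqrt (d * p) + 2 * (d * p))"
  proof (rule mult_left_mono)
    have "0 \<le> sqrt (d * p) * (d * p)" using bd p0 by simp
    moreover have "(sqrt (d * p))\<^sup>2 = d * p" using bd p0 by simp
    ultimately show "sqrt (d * p + 3 * d\<^sup>2 * p\<^sup>2) \<le> sqrt (d * p) + 2 * (d * p)"
      using bd p0 by (intro real_le_lsqrt) (auto simp: power2_sum power_mult_distrib)
  qed (use bd p0 in simp)
  also have "\<dots> = p * sqrt (b * d) + 2 * p * sqrt p * sqrt b * d"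
    using p0 bd by (simp add: real_sqrt_mult algebra_simps)
  also have "\<dots> \<le> p * d + 2 * p * sqrt p * sqrt (sqrt (2 * m)) * d"
  proof (intro add_mono mult_left_mono mult_right_mono)
    have "b * d \<le> d * d" using bd by (intro mult_right_mono) auto
    then show "sqrt (b * d) \<le> d" using bd by (intro real_le_lsqrt) (auto simp: power2_eq_square)
    show "sqrt b \<le> sqrt (sqrt (2 * m))" using bd by simp
  qed (use bd p0 in auto)
  finally show ?thesis unfolding d_def .
qed

lemma sum_expect_abs_third:
  "(\<Sum>v\<in>V. expect (\<lambda>X. \<bar>star_sum (back_nbrs v) v X * (star_sum (nbrs v) v X)\<^sup>2\<bar>))
    \<le> 2 * m * (p + 2 * p * sqrt p * sqrt (sqrt (2 * m)))"
proof -
  have "(\<Sum>v\<in>V. expect (\<lambda>X. \<bar>star_sum (back_nbrs v) v X * (star_sum (nbrs v) v X)\<^sup>2\<bar>))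
    \<le> (\<Sum>v\<in>V. (p + 2 * p * sqrt p * sqrt (sqrt (2 * m))) * real (deg v))"
    using expect_abs_third by (intro sum_mono) (simp add: algebra_simps)
  then show ?thesis unfolding sum_distrib_left[symmetric] handshake by (simp add: algebra_simps)
qed

text \<open>The star at \<open>v\<close> is removed from \<open>T\<close> before \<open>D v\<close> is tested against it, which makes the
  leading term vanish; the first-order Taylor terms add up to \<open>f' (T / s) * cross_sum / s\<^sup>2\<close>.\<close>

lemma stein_identity_error:
  fixes f f' :: "real \<Rightarrow> real"
  assumes s: "s > 0" "s\<^sup>2 = m * q"
    and der: "\<And>w. (f has_real_derivative f' w) (at w)"
    and bnd: "\<And>w. \<bar>f' w\<bar> \<le> a"
    and lip: "\<And>x y. \<bar>f' x - f' y\<bar> \<le> B * \<bar>x - y\<bar>"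
  shows "\<bar>expect (\<lambda>X. f' (T X / s) - T X / s * f (T X / s))\<bar>
    \<le> a * (sqrt (expect (\<lambda>X. (cross_sum X - m * q)\<^sup>2)) / s\<^sup>2)
     + B * ((\<Sum>v\<in>V. expect (\<lambda>X. \<bar>star_sum (back_nbrs v) v X * (star_sum (nbrs v) v X)\<^sup>2\<bar>)) / s ^ 3)"
proof -
  define D where "D v = star_sum (back_nbrs v) v" for v
  define N where "N v = star_sum (nbrs v) v" for v
  define W where "W X = T X / s" for X
  have a0: "a \<ge> 0" using bnd[of 0] by linarith
  have zero: "expect (\<lambda>X. D v X * f (W X - N v X / s)) = 0" if v: "v \<in> V" for v
  proof (rule expect_orthogonal[OF v])
    fix X assume X: "X \<in> \<Omega>"
    have "resample_mean v (D v) X = (\<Sum>u\<in>back_nbrs v. resample_mean v (Y u v) X)"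
      unfolding resample_mean_def D_def star_sum_def sum_divide_distrib[symmetric] by (subst sum.swap) simp
    also have "\<dots> = 0" using X nbrsD by (intro sum.neutral ballI resample_mean_Y) (auto simp: back_nbrs_def)
    finally show "resample_mean v (D v) X = 0" .
  next
    fix X a
    have "W X - N v X / s = (T X - N v X) / s" for X by (simp add: W_def diff_divide_distrib)
    then show "f (W (X(v := a)) - N v (X(v := a)) / s) = f (W X - N v X / s)"
      using T_minus_star_free[OF v, of X a] by (simp add: N_def)
  qed
  define \<rho> where "\<rho> v X = D v X * (f (W X) - f (W X - N v X / s) - f' (W X) * (N v X / s))" for v X
  have \<rho>: "\<bar>\<rho> v X\<bar> \<le> B / s\<^sup>2 * \<bar>D v X * (N v X)\<^sup>2\<bar>" for v X
  proof -
    have "\<bar>\<rho> v X\<bar> \<le> \<bar>D v X\<bar> * (B * (N v X / s)\<^sup>2)"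
      unfolding \<rho>_def abs_mult by (intro mult_left_mono taylor_lipschitz[OF der lip]) auto
    then show ?thesis by (simp add: power_divide abs_mult field_simps)
  qed
  have sumD: "(\<Sum>v\<in>V. D v X) = T X" for X by (simp add: T_def D_def)
  have sumDN: "(\<Sum>v\<in>V. D v X * N v X) = cross_sum X" for X by (simp add: cross_sum_def D_def N_def)
  have eq: "f' (W X) - W X * f (W X) = f' (W X) * (1 - cross_sum X / s\<^sup>2) 
      - ((\<Sum>v\<in>V. \<rho> v X) / s + (\<Sum>v\<in>V. D v X * f (W X - N v X / s)) / s)" for X
  proof -
    have "W X * f (W X) = (\<Sum>v\<in>V. D v X * f (W X)) / s"
      by (simp add: sum_distrib_right[symmetric] sumD W_def)
    also have "(\<Sum>v\<in>V. D v X * f (W X)) = (\<Sum>v\<in>V. \<rho> v X + D v X * f (W X - N v X / s) + f' (W X) / s * (D v X * N v X))"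
      by (intro sum.cong refl) (simp add: \<rho>_def algebra_simps)
    also have "\<dots> = (\<Sum>v\<in>V. \<rho> v X) + (\<Sum>v\<in>V. D v X * f (W X - N v X / s)) + f' (W X) / s * cross_sum X"
      by (simp only: sum.distrib sum_distrib_left[symmetric] sumDN)
    finally show ?thesis using s(1) by (simp add: field_simps power2_eq_square)
  qed
  have "expect (\<lambda>X. f' (W X) - W X * f (W X)) = expect (\<lambda>X. f' (W X) * (1 - cross_sum X / s\<^sup>2)) - (\<Sum>v\<in>V. expect (\<rho> v)) / s"
    unfolding eq by (simp add: zero)
  then have "\<bar>expect (\<lambda>X. f' (W X) - W X * f (W X))\<bar> \<le> \<bar>expect (\<lambda>X. f' (W X) * (1 - cross_sum X / s\<^sup>2))\<bar> + \<bar>\<Sum>v\<in>V. expect (\<rho> v)\<bar> / s"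
    using s(1) abs_triangle_ineq4[of "expect (\<lambda>X. f' (W X) * (1 - cross_sum X / s\<^sup>2))" "(\<Sum>v\<in>V. expect (\<rho> v)) / s"]
    by (simp add: abs_divide)
  also have "\<bar>expect (\<lambda>X. f' (W X) * (1 - cross_sum X / s\<^sup>2))\<bar> \<le> a * (sqrt (expect (\<lambda>X. (cross_sum X - m * q)\<^sup>2)) / s\<^sup>2)"
  proof -
    have "\<bar>expect (\<lambda>X. f' (W X) * (1 - cross_sum X / s\<^sup>2))\<bar> \<le> expect (\<lambda>X. \<bar>f' (W X) * (1 - cross_sum X / s\<^sup>2)\<bar>)"
      by (rule integral_abs_bound)
    also have "\<dots> \<le> expect (\<lambda>X. a / s\<^sup>2 * \<bar>(cross_sum X - m * q) * 1\<bar>)"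
    proof (rule expect_mono)
      fix X
      have "\<bar>1 - cross_sum X / s\<^sup>2\<bar> = \<bar>cross_sum X - m * q\<bar> / s\<^sup>2"
      proof -
        have "1 - cross_sum X / s\<^sup>2 = (m * q - cross_sum X) / s\<^sup>2" using s by (simp add: diff_divide_distrib flip: s(2))
        then show ?thesis using s(1) by (simp add: abs_minus_commute)
      qed
      then show "\<bar>f' (W X) * (1 - cross_sum X / s\<^sup>2)\<bar> \<le> a / s\<^sup>2 * \<bar>(cross_sum X - m * q) * 1\<bar>"
        using mult_right_mono[OF bnd[of "W X"], of "\<bar>cross_sum X - m * q\<bar> / s\<^sup>2"] by (simp add: abs_mult)
    qed
    also have "\<dots> = a / s\<^sup>2 * expect (\<lambda>X. \<bar>(cross_sum X - m * q) * 1\<bar>)" by simp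
    also have "\<dots> \<le> a / s\<^sup>2 * (sqrt (expect (\<lambda>X. (cross_sum X - m * q)\<^sup>2)) * sqrt (expect (\<lambda>X. 1\<^sup>2)))"
      using a0 by (intro mult_left_mono pmf_cauchy_schwarz) auto
    finally show ?thesis by simp
  qed
  also have "\<bar>\<Sum>v\<in>V. expect (\<rho> v)\<bar> \<le> (\<Sum>v\<in>V. B / s\<^sup>2 * expect (\<lambda>X. \<bar>D v X * (N v X)\<^sup>2\<bar>))"
  proof (rule order_trans[OF sum_abs], rule sum_mono)
    fix v
    have "\<bar>expect (\<rho> v)\<bar> \<le> expect (\<lambda>X. \<bar>\<rho> v X\<bar>)" by (rule integral_abs_bound)
    also have "\<dots> \<le> expect (\<lambda>X. B / s\<^sup>2 * \<bar>D v X * (N v X)\<^sup>2\<bar>)" by (rule expect_mono) (rule \<rho>)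
    finally show "\<bar>expect (\<rho> v)\<bar> \<le> B / s\<^sup>2 * expect (\<lambda>X. \<bar>D v X * (N v X)\<^sup>2\<bar>)" by simp
  qed
  also have "(\<Sum>v\<in>V. B / s\<^sup>2 * expect (\<lambda>X. \<bar>D v X * (N v X)\<^sup>2\<bar>)) / s 
    = B * ((\<Sum>v\<in>V. expect (\<lambda>X. \<bar>D v X * (N v X)\<^sup>2\<bar>)) / s ^ 3)"
    by (simp only: sum_distrib_left[symmetric]) (simp add: power2_eq_square power3_eq_cube)
  finally show ?thesis unfolding W_def D_def N_def using s(1) by (simp add: divide_right_mono)
qed

definition rate :: real where
  "rate = c / m + 1 / sqrt m + num_copies (cycle_graph 4) G / (c * m\<^sup>2)"

text \<open>The factor \<open>110\<close> of both error terms enters as \<open>\<epsilon> = 110 * sqrt rate\<close>, and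
  \<open>1651 = 1 + 9 * 110 + 6 * 110\<close> collects the contributions of the smoothing and of the two
  error terms.\<close>

lemma T_kolmogorov:
  assumes m: "m \<ge> 1"
  shows "\<bar>measure_pmf.prob (random_coloring G c) {X. T X / sqrt (m * q) \<le> x} - cdf std_normal_distribution x\<bar>
    \<le> 1651 * rate powr (1 / 5)"
proof -
  interpret S: prob_space std_normal_distribution by (rule prob_space_normal_density) simp
  define s where "s = sqrt (m * q)"
  have s: "s > 0" "s\<^sup>2 = m * q" using m p_bounds by (auto simp: s_def)
  let ?N = "real (num_copies (cycle_graph 4) G)"
  have rate: "rate = 1 / (p * m) + 1 / sqrt m + p * ?N / m\<^sup>2"
    by (simp add: rate_def p_def)
  have rate0: "rate > 0" unfolding rate using m p_bounds by (intro add_pos_nonneg) auto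
  show ?thesis
  proof (cases "rate \<le> 1")
    case False
    have "1 powr (1 / 5) \<le> rate powr (1 / 5)" using False by (intro powr_mono2) auto
    moreover have "\<bar>measure_pmf.prob (random_coloring G c) {X. T X / sqrt (m * q) \<le> x} - cdf std_normal_distribution x\<bar> \<le> 1"
      using measure_pmf.prob_le_1[of "random_coloring G c" "{X. T X / sqrt (m * q) \<le> x}"]
        S.prob_le_1[of "{..x}"] measure_nonneg[of std_normal_distribution "{..x}"]
        measure_nonneg[of "random_coloring G c" "{X. T X / sqrt (m * q) \<le> x}"]
      unfolding cdf_def abs_le_iff by linarith
    ultimately show ?thesis by simp
  next
    case True
    \<comment> \<open>The smoothing scale \<open>sqrt \<eta>\<close> balances the two error contributions \<open>\<delta>\<close> and \<open>\<eta> / \<delta>\<close>.\<close>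
    define \<eta> where "\<eta> = sqrt rate"
    have \<eta>: "0 < \<eta>" "\<eta> \<le> 1" using rate0 True by (auto simp: \<eta>_def)
    have "\<bar>measure (random_coloring G c) {X\<in>space (random_coloring G c). T X / s \<le> x} - cdf std_normal_distribution x\<bar>
      \<le> sqrt \<eta> + (9 + 6 / sqrt \<eta>) * (110 * \<eta>)"
    proof (rule kolmogorov_bound_by_stein)
      fix f f' :: "real \<Rightarrow> real" and a B
      assume f: "\<And>w. (f has_real_derivative f' w) (at w)" "\<And>w. \<bar>f' w\<bar> \<le> a" "\<And>x y. \<bar>f' x - f' y\<bar> \<le> B * \<bar>x - y\<bar>"
      have a0: "a \<ge> 0" using f(2)[of 0] by linarith
      have B0: "B \<ge> 0" using f(3)[of 1 0] by (simp add: abs_le_iff)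
      note stein_identity_error[OF s f]
      also have "a * (sqrt (expect (\<lambda>X. (cross_sum X - m * q)\<^sup>2)) / s\<^sup>2)
         + B * ((\<Sum>v\<in>V. expect (\<lambda>X. \<bar>star_sum (back_nbrs v) v X * (star_sum (nbrs v) v X)\<^sup>2\<bar>)) / s ^ 3)
        \<le> a * (110 * \<eta>) + B * (110 * \<eta>)"
        unfolding \<eta>_def rate
        by (intro add_mono mult_left_mono variance_term_bound[OF m p_bounds(1,3) _ s expect_cross_sum_deviation]
            third_moment_term_bound[OF m p_bounds(1,3) _ s sum_expect_abs_third] a0 B0) auto
      finally show "\<bar>expect (\<lambda>X. f' (T X / s) - T X / s * f (T X / s))\<bar> \<le> (a + B) * (110 * \<eta>)"
        by (simp add: algebra_simps)
    qed (use \<eta> in \<open>auto intro: measure_pmf.prob_space_axioms\<close>)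
    also have "\<dots> \<le> 1651 * sqrt \<eta>"
    proof -
      have "\<eta> \<le> sqrt \<eta>" using \<eta> by (intro real_le_rsqrt) (simp add: power2_eq_square mult_left_le)
      moreover have "\<eta> / sqrt \<eta> = sqrt \<eta>" using \<eta> by (simp add: real_div_sqrt)
      ultimately show ?thesis by (simp add: algebra_simps)
    qed
    also have "sqrt \<eta> = rate powr (1 / 4)"
      using rate0 by (simp add: \<eta>_def powr_half_sqrt[symmetric] powr_powr)
    also have "\<dots> \<le> rate powr (1 / 5)" using rate0 True by (intro powr_mono') auto
    finally show ?thesis by (simp add: s_def)
  qed
qed

end

text \<open>The same edge sum is taken along the vertex order on the left and along the orientation by
  degrees in \<open>T\<close>.\<close>

lemma (in colored_graph) T_eq_monochromatic:
  "(\<Sum>v\<in>V. \<Sum>u\<in>{u\<in>nbrs v. u < v}. of_bool (X u = X v)) = T X + m * p"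
proof -
  have "2 * (\<Sum>v\<in>V. \<Sum>u\<in>{u\<in>nbrs v. u < v}. of_bool (X u = X v) :: real) = (\<Sum>v\<in>V. \<Sum>u\<in>nbrs v. of_bool (X u = X v))"
    by (rule sum_less) auto
  also have "\<dots> = (\<Sum>v\<in>V. star_sum (nbrs v) v X + p * real (deg v))"
    by (intro sum.cong refl) (simp add: star_sum_def Y_def sum_subtractf deg_def)
  also have "\<dots> = 2 * T X + p * (2 * m)"
    by (simp only: sum.distrib two_T sum_distrib_left[symmetric] handshake)
  finally have "2 * (\<Sum>v\<in>V. \<Sum>u\<in>{u\<in>nbrs v. u < v}. of_bool (X u = X v)) = 2 * T X + p * (2 * m)" .
  moreover have "x = t + m * p" if "2 * x = 2 * t + p * (2 * m)" for x t
    using that by (simp add: algebra_simps)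
  ultimately show ?thesis by blast
qed

lemma T2_eq:
  assumes "colored_graph G c" and V: "verts G = {1..card (verts G)}"
  shows "T2 G X = colored_graph.T G c X + colored_graph.m G * colored_graph.p c"
proof -
  interpret colored_graph G c by fact
  define S where "S = {(s1, s2). 1 \<le> s1 \<and> s1 < s2 \<and> s2 \<le> card (verts G)}"
  have inV: "v \<in> V \<longleftrightarrow> 1 \<le> v \<and> v \<le> card V" for v by (subst V) simp
  have "T2 G X = (\<Sum>(v, u)\<in>(SIGMA v:V. {u\<in>V. u < v}). adj G u v * of_bool (X u = X v))"
    unfolding T2_def S_def[symmetric]
    by (rule sum.reindex_bij_witness[of _ prod.swap prod.swap]) (auto simp: S_def inV)
  also have "\<dots> = (\<Sum>v\<in>V. \<Sum>u\<in>{u\<in>V. u < v}. adj G u v * of_bool (X u = X v))"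
    by (subst sum.Sigma) auto
  also have "\<dots> = (\<Sum>v\<in>V. \<Sum>u\<in>{u\<in>nbrs v. u < v}. of_bool (X u = X v))"
  proof (rule sum.cong[OF refl])
    fix v
    have eq: "{u\<in>nbrs v. u < v} = {u\<in>{u\<in>V. u < v}. u \<in> nbrs v}" using nbrs_subset by auto
    have "(\<Sum>u\<in>{u\<in>nbrs v. u < v}. of_bool (X u = X v)) 
      = (\<Sum>u\<in>{u\<in>V. u < v}. if u \<in> nbrs v then of_bool (X u = X v) else 0 :: real)"
      unfolding eq by (rule sum.inter_filter) simp
    also have "\<dots> = (\<Sum>u\<in>{u\<in>V. u < v}. adj G u v * of_bool (X u = X v))"
      by (intro sum.cong refl) (simp add: adj_def nbrs_def)
    finally show "(\<Sum>u\<in>{u\<in>V. u < v}. adj G u v * of_bool (X u = X v)) = (\<Sum>u\<in>{u\<in>nbrs v. u < v}. of_bool (X u = X v))" ..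
  qed
  finally show ?thesis using T_eq_monochromatic[of X] by simp
qed

theorem Z2_kolmogorov:
  assumes G: "simple_graph G" "verts G = {1..card (verts G)}" and m: "card (edges G) \<ge> 1" and c: "c \<ge> 2"
  shows "\<bar>measure_pmf.prob (random_coloring G c) {X. Z2 G c X \<le> x} - cdf std_normal_distribution x\<bar>
    \<le> 1651 * (real c / real (card (edges G)) + 1 / sqrt (real (card (edges G)))
      + real (num_copies (cycle_graph 4) G) / (real c * (real (card (edges G)))\<^sup>2)) powr (1 / 5)"
proof -
  interpret colored_graph G c by unfold_locales fact+
  have T2: "T2 G = (\<lambda>X. T X + m * p)"
    using T2_eq[OF colored_graph_axioms G(2)] by auto
  have mean: "expect (T2 G) = m * p" unfolding T2 by (simp add: expect_T)
  have var: "measure_pmf.variance (random_coloring G c) (T2 G) = m * q"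
    unfolding mean unfolding T2 by (simp add: expect_T2)
  have "Z2 G c X = T X / sqrt (m * q)" for X
    unfolding Z2_def var unfolding mean unfolding T2 by simp
  moreover have "m \<ge> 1" using m by (simp add: m_def)
  ultimately show ?thesis using T_kolmogorov[of x] by (simp add: rate_def m_def)
qed

theorem theorem1p4:
  "\<exists>K::real. K > 0 \<and>
     (\<forall>(G :: nat \<Rightarrow> nat ugraph) (c :: nat \<Rightarrow> nat).
        (\<forall>n\<ge>1. simple_graph (G n) \<and> verts (G n) = {1..card (verts (G n))} \<and>
                card (edges (G n)) \<ge> 1 \<and> c n \<ge> 2) \<longrightarrow>
        (\<forall>n\<ge>1.
           (SUP x::real. \<bar>measure_pmf.prob (random_coloring (G n) (c n)) {X. Z2 (G n) (c n) X \<le> x}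
                          - cdf std_normal_distribution x\<bar>)
           \<le> K * (real (c n) / real (card (edges (G n)))
                   + 1 / sqrt (real (card (edges (G n))))
                   + real (num_copies (cycle_graph 4) (G n))
                       / (real (c n) * (real (card (edges (G n))))\<^sup>2)) powr (1 / 5)))"
  by (intro exI[of _ 1651] conjI allI impI cSUP_least Z2_kolmogorov) auto

end
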